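(* Let $K\in\mathbb{N}$, $\beta\in(0,1)$, $\tau\in[0,1)$. Let $\mathcal{D}=\bigcup_{k=1}^K\{(X_i^k,Y_i^k)\}_{i=1}^{n_k}$ be calibration data, with $(X_i^k,Y_i^k)\sim\mathbb{P}^k=\mathbb{P}_{Y|X}\mathbb{P}_X^k$, let $(X,Y)\sim\mathbb{P}=\mathbb{P}_{Y|X}\mathbb{P}_X=\mathbb{P}^1$ be a test point, let $\hat{s}$ be a pre-trained score function, let $\omega^k=\mathrm{d}\mathbb{P}_X/\mathrm{d}\mathbb{P}_X^k$, and let $\hat\omega^k$ be the weight functions used in the prediction set $\mathcal{C}^{\mathrm{wqq}}_{\beta,\tau}(X)$ (all as specified in the context). Assume that the scores are continuously distributed (the cumulative distribution function $F_{\hat s}$ of $\hat s(X,Y)$, $(X,Y)\sim\mathbb{P}$, is continuous), that $\hat\omega^k\equiv\omega^k$ for all $k\in[K]$, that $\mathbb{P}$ is absolutely continuous with respect to $\mathbb{P}^k$ for all $k\in[K]$, and that there exist finite constants $0<A\le 1\le B$ such that $\mathbb{P}_X^k(\omega^k(X_i^k)\in[A,B])=1$ for $X_i^k\sim\mathbb{P}_X^k$, $k\in[K]$, $i\in[n_k]$. Then, as $n_1,\dots,n_K\to\infty$, $$\mathbb{P}\big(Y\in\mathcal{C}^{\mathrm{wqq}}_{\beta,\tau}(X)\,\big|\,\mathcal{D}\big)\ \stackrel{d}{\to}\ \mathrm{Quantile}\Big(1-\tau;\ \sum_{k=1}^K w_k\,\delta_{U_\beta^k}\Big),$$ where $U_\beta^k\sim\mathrm{Beta}\big((1-\beta)(n_{\mathrm{eff}}^k+1),\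 \beta(n_{\mathrm{eff}}^k+1)\big)$ and $$n_{\mathrm{eff}}^k=\frac{\Vert[\omega_1^k,\dots,\omega_{n_k}^k]\Vert_1^2}{\Vert[\omega_1^k,\dots,\omega_{n_k}^k]\Vert_2^2},\qquad \omega_i^k=\omega^k(X_i^k).$$ Since the right-hand side itself depends on $n_1,\dots,n_K$, the relation $\stackrel{d}{\to}$ means that the Lévy distance between the law of the left-hand random variable and the law of the right-hand random variable tends to $0$ as $n_1,\dots,n_K\to\infty$.
   Context: $[K]=\{1,\dots,K\}$. $\mathcal{X}$ is the covariate space, $\mathcal{Y}$ the label space, and $\mathbb{P}_{Y|X}$ is a common conditional law of the label given the covariate; only the covariate marginals $\mathbb{P}_X^k$ differ between the $K$ agents (covariate shift). The test law is that of agent $1$: $\mathbb{P}=\mathbb{P}^1$, so $\omega^1\equiv1$. Standing assumptions: for each $k$ the calibration points $Z_i^k=(X_i^k,Y_i^k)$, $i=1,\dots,n_k$, are exchangeable with law $\mathbb{P}^k$; the data of different agents are independent; the training data are independent of the calibration data $\mathcal{D}$; the test point is independent of $\mathcal{D}$ and of the training data. The score function $\hat s:\mathcal{X}\times\mathcal{Y}\to\mathbb{R}$ and the weight functions $\hat\omega^k:\mathcal{X}\to\mathbb{R}$ are obtained from the training data only, and are thus treated as fixed functions. Write $\hat s_i^k=\hat s(X_i^k,Y_i^k)$, $\hat\omega_i^k=\hat\omega^k(X_i^k)$, $\bar\omega^k=\sum_{j=1}^{n_k}\hat\omega_j^k$. For a probability measure $\mu$ on $\mathbb{R}\cup\{\infty\}$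 and $q\in(0,1]$, $\mathrm{Quantile}(q;\mu)=\inf\{x:\mu((-\infty,x])\ge q\}$ (with value $\infty$ if the set is empty); $\delta_x$ is the Dirac mass at $x$. The weights $w_k\ge 0$ are normalized, $\sum_{k=1}^K w_k=1$; they are either fixed or (the paper's choice) $w_k=n_{\mathrm{eff}}^k/\sum_{l=1}^K n_{\mathrm{eff}}^l$. The prediction set is $\mathcal{C}^{\mathrm{wqq}}_{\beta,\tau}(X)=\{y\in\mathcal{Y}:\hat s(X,y)\le Q_{\beta,\tau}\}$, with $$Q_{\beta,\tau}=\mathrm{Quantile}\Big(1-\tau;\sum_{k=1}^K w_k\delta_{Q_\beta^k}\Big),\qquad Q_\beta^k=\mathrm{Quantile}\Big(1-\beta;\frac{\sum_{i=1}^{n_k}\hat\omega_i^k\delta_{\hat s_i^k}+\hat\omega^k(X)\delta_\infty}{\bar\omega^k+\hat\omega^k(X)}\Big).$$ Conditionally on $\mathcal{D}$, the variables $U_\beta^1,\dots,U_\beta^K$ are independent with the stated Beta laws.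
   Formalization: The calibration points of each agent are taken i.i.d. with law P^k (all points mutually independent) rather than merely exchangeable; with bare exchangeability the claim fails, e.g. K=1, β=1/2, τ=0, ω≡1 and all points equal to the first one. *)

theory Defs
  imports "HOL-Probability.Probability"
begin

text \<open>
  Sample sizes are functions \<open>n :: nat \<Rightarrow> nat\<close>, of which only the values on \<open>{1..K}\<close> matter.
  Calibration data are functions \<open>d\<close> with \<open>d (k, i)\<close> the \<open>i\<close>-th (covariate, label) pair of
  agent \<open>k\<close>, for \<open>(k, i) \<in> data_index K n\<close>.
\<close>

definition data_index :: "nat \<Rightarrow> (nat \<Rightarrow> nat) \<Rightarrow> (nat \<times> nat) set" where
  "data_index K n = (SIGMA k:{1..K}. {1..n k})"

text \<open>All of \<open>n 1, \<dots>, n K\<close> tend to infinity jointly, with no restriction on relative rates.\<close>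

definition sizes_at_top :: "nat \<Rightarrow> (nat \<Rightarrow> nat) filter" where
  "sizes_at_top K = (INF k\<in>{1..K}. filtercomap (\<lambda>n. n k) at_top)"

text \<open>The law of \<open>(X, Y)\<close> when \<open>X\<close> has law \<open>\<mu>\<close> and \<open>Y\<close> has law \<open>\<kappa> x\<close> given \<open>X = x\<close>.\<close>

definition joint_law ::
    "'x measure \<Rightarrow> 'y measure \<Rightarrow> 'x measure \<Rightarrow> ('x \<Rightarrow> 'y measure) \<Rightarrow> ('x \<times> 'y) measure" where
  "joint_law MX MY \<mu> \<kappa> = \<mu> \<bind> (\<lambda>x. distr (\<kappa> x) (MX \<Otimes>\<^sub>M MY) (Pair x))"

text \<open>
  Measures on \<open>\<real> \<union> {\<infinity>}\<close> are measures on \<^typ>\<open>ereal\<close>. The infimum is over finite \<open>x\<close>, and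
  \<open>Inf {} = \<infinity>\<close>.
\<close>

definition Quantile :: "real \<Rightarrow> ereal measure \<Rightarrow> ereal" where
  "Quantile q \<mu> = Inf {ereal x | x::real. q \<le> measure \<mu> {-\<infinity><..ereal x}}"

text \<open>The measure \<open>\<Sum>i\<in>I. c i \<cdot> \<delta>\<^bsub>p i\<^esub>\<close>, for finite \<open>I\<close> and \<open>c \<ge> 0\<close>.\<close>

definition dirac_mixture :: "'i set \<Rightarrow> ('i \<Rightarrow> real) \<Rightarrow> ('i \<Rightarrow> ereal) \<Rightarrow> ereal measure" where
  "dirac_mixture I c p = distr (point_measure I (\<lambda>i. ennreal (c i))) borel p"

text \<open>
  The weighted conformal quantile of agent \<open>k\<close> at test covariate \<open>x\<close>. Index \<open>0\<close> carries the atom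
  at \<open>\<infinity>\<close>, indices \<open>1, \<dots>, n k\<close> the calibration scores.
\<close>

definition agent_quantile ::
    "('x \<times> 'y \<Rightarrow> real) \<Rightarrow> (nat \<Rightarrow> 'x \<Rightarrow> real) \<Rightarrow> (nat \<Rightarrow> nat) \<Rightarrow> (nat \<times> nat \<Rightarrow> 'x \<times> 'y) \<Rightarrow>
     real \<Rightarrow> nat \<Rightarrow> 'x \<Rightarrow> ereal" where
  "agent_quantile s \<omega> n d \<beta> k x =
     Quantile (1 - \<beta>)
       (dirac_mixture {0..n k}
         (\<lambda>i. (if i = 0 then \<omega> k x else \<omega> k (fst (d (k, i)))) /
              ((\<Sum>j=1..n k. \<omega> k (fst (d (k, j)))) + \<omega> k x))
         (\<lambda>i. if i = 0 then \<infinity> else ereal (s (d (k, i)))))"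

definition wqq_threshold ::
    "('x \<times> 'y \<Rightarrow> real) \<Rightarrow> (nat \<Rightarrow> 'x \<Rightarrow> real) \<Rightarrow> nat \<Rightarrow> (nat \<Rightarrow> nat) \<Rightarrow> (nat \<Rightarrow> real) \<Rightarrow>
     (nat \<times> nat \<Rightarrow> 'x \<times> 'y) \<Rightarrow> real \<Rightarrow> real \<Rightarrow> 'x \<Rightarrow> ereal" where
  "wqq_threshold s \<omega> K n w d \<beta> \<tau> x =
     Quantile (1 - \<tau>) (dirac_mixture {1..K} w (\<lambda>k. agent_quantile s \<omega> n d \<beta> k x))"

definition wqq_prediction_set ::
    "'y measure \<Rightarrow> ('x \<times> 'y \<Rightarrow> real) \<Rightarrow> (nat \<Rightarrow> 'x \<Rightarrow> real) \<Rightarrow> nat \<Rightarrow> (nat \<Rightarrow> nat) \<Rightarrow> (nat \<Rightarrow> real) \<Rightarrow>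
     (nat \<times> nat \<Rightarrow> 'x \<times> 'y) \<Rightarrow> real \<Rightarrow> real \<Rightarrow> 'x \<Rightarrow> 'y set" where
  "wqq_prediction_set MY s \<omega> K n w d \<beta> \<tau> x =
     {y \<in> space MY. ereal (s (x, y)) \<le> wqq_threshold s \<omega> K n w d \<beta> \<tau> x}"

definition n_eff ::
    "(nat \<Rightarrow> 'x \<Rightarrow> real) \<Rightarrow> (nat \<Rightarrow> nat) \<Rightarrow> (nat \<times> nat \<Rightarrow> 'x \<times> 'y) \<Rightarrow> nat \<Rightarrow> real" where
  "n_eff \<omega> n d k =
     (\<Sum>i=1..n k. \<bar>\<omega> k (fst (d (k, i)))\<bar>)\<^sup>2 / (L2_set (\<lambda>i. \<omega> k (fst (d (k, i)))) {1..n k})\<^sup>2"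

text \<open>
  The aggregation weights are either deterministic (possibly depending on the sample sizes) or
  proportional to the effective sample sizes.
\<close>

definition aggregation_weights ::
    "nat \<Rightarrow> (nat \<Rightarrow> 'x \<Rightarrow> real) \<Rightarrow>
     ((nat \<Rightarrow> nat) \<Rightarrow> (nat \<times> nat \<Rightarrow> 'x \<times> 'y) \<Rightarrow> nat \<Rightarrow> real) \<Rightarrow> bool" where
  "aggregation_weights K \<omega> w \<longleftrightarrow>
     (\<exists>v. (\<forall>n. (\<forall>k\<in>{1..K}. 0 \<le> v n k) \<and> (\<Sum>k=1..K. v n k) = 1) \<and>
          (\<forall>n d. \<forall>k\<in>{1..K}. w n d k = v n k)) \<or>
     (\<forall>n d. \<forall>k\<in>{1..K}. w n d k = n_eff \<omega> n d k / (\<Sum>l=1..K. n_eff \<omega> n d l))"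

definition beta_law :: "real \<Rightarrow> real \<Rightarrow> real measure" where
  "beta_law a b = density lborel (\<lambda>x. ennreal
     (indicator {0<..<1} x * x powr (a - 1) * (1 - x) powr (b - 1) / Beta a b))"

text \<open>
  Independence of random variables with values in two different types, which
  \<^const>\<open>prob_space.indep_var\<close> does not cover.
\<close>

definition independent_rvs ::
    "'w measure \<Rightarrow> 'd measure \<Rightarrow> ('w \<Rightarrow> 'd) \<Rightarrow> 'e measure \<Rightarrow> ('w \<Rightarrow> 'e) \<Rightarrow> bool" where
  "independent_rvs M S X T Y \<longleftrightarrow> X \<in> M \<rightarrow>\<^sub>M S \<and> Y \<in> M \<rightarrow>\<^sub>M T \<and>
     prob_space.indep_set M {X -` C \<inter> space M | C. C \<in> sets S} {Y -` C \<inter> space M | C. C \<in> sets T}"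

definition prob_given ::
    "'w measure \<Rightarrow> 'd measure \<Rightarrow> ('w \<Rightarrow> 'd) \<Rightarrow> 'w set \<Rightarrow> 'w \<Rightarrow> real" where
  "prob_given M S D E = real_cond_exp M (vimage_algebra (space M) D S) (indicator E)"

definition levy_dist :: "real measure \<Rightarrow> real measure \<Rightarrow> real" where
  "levy_dist \<mu> \<nu> =
     Inf {e. 0 < e \<and> (\<forall>x. cdf \<mu> (x - e) - e \<le> cdf \<nu> x \<and> cdf \<nu> x \<le> cdf \<mu> (x + e) + e)}"

end

theory Submission
  imports Defs
begin

text \<open>
  Both sides converge in probability to the constant \<open>1 - \<beta>\<close>, which forces their Levy distance
  to \<open>0\<close>. On the left, \<open>\<omega>\<^sup>k\<close> reweights agent \<open>k\<close>'s law to the test law, so by Hoeffding's inequality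
  the weighted empirical distribution functions of the scores are close to the test distribution
  function \<open>F\<close> at two points \<open>t\<^sub>1\<close>, \<open>t\<^sub>2\<close> with \<open>F t\<^sub>1 = 1 - \<beta> - \<epsilon>\<close> and \<open>F t\<^sub>2 = 1 - \<beta> + \<epsilon>\<close>. Every agent's
  quantile, hence also their weighted quantile, then lies in \<open>[t\<^sub>1, t\<^sub>2]\<close>, whatever the test covariate, and
  independence of test point and data bounds the conditional coverage by the two values of \<open>F\<close>.
  On the right, \<open>n\<^sub>e\<^sub>f\<^sub>f \<ge> n (A / B)\<^sup>2\<close> makes the variance of each Beta law vanish, and a quantile
  of a convex combination of point masses lies between the smallest and the largest of them.
\<close>

section \<open>Levy distance and quantiles of Dirac mixtures\<close>

text \<open>Each cdf is at most \<open>\<delta>\<close> to the left of \<open>c - \<delta>\<close>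
  and at least \<open>1 - \<delta>\<close> from \<open>c + \<delta>\<close> on, and a shift by
  \<open>2 * \<delta>\<close> jumps over the interval between. Concentration at a common point thus
  suffices to compare two laws.\<close>

lemma levy_dist_le_concentration:
  assumes \<mu>: "real_distribution \<mu>" and \<nu>: "real_distribution \<nu>" and \<delta>: "0 < \<delta>"
    and \<mu>_conc: "measure \<mu> {x. \<delta> < \<bar>x - c\<bar>} \<le> \<delta>"
    and \<nu>_conc: "measure \<nu> {x. \<delta> < \<bar>x - c\<bar>} \<le> \<delta>"
  shows "0 \<le> levy_dist \<mu> \<nu>" "levy_dist \<mu> \<nu> \<le> 2 * \<delta>"
proof -
  have low: "cdf M x \<le> \<delta>" if "real_distribution M" "measure M {x. \<delta> < \<bar>x - c\<bar>} \<le> \<delta>" "x < c - \<delta>"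
    for M x
  proof -
    interpret real_distribution M by fact
    have "measure M {..x} \<le> measure M {x. \<delta> < \<bar>x - c\<bar>}"
      using that(3) by (intro finite_measure_mono) auto
    then show ?thesis using that(2) by (simp add: cdf_def)
  qed
  have high: "1 - \<delta> \<le> cdf M x" if "real_distribution M" "measure M {x. \<delta> < \<bar>x - c\<bar>} \<le> \<delta>" "c + \<delta> \<le> x"
    for M x
  proof -
    interpret real_distribution M by fact
    have "1 - measure M {..x} = measure M (space M - {..x})"
      by (subst prob_compl) auto
    also have "\<dots> \<le> measure M {x. \<delta> < \<bar>x - c\<bar>}"
      using that(3) by (intro finite_measure_mono) auto
    finally show ?thesis using that(2) by (simp add: cdf_def)
  qed
  \<comment> \<open>Stated for any ordered pair of laws: with the roles exchanged and
    \<open>x + 2 * \<delta>\<close> for \<open>x\<close> it also yields the second inequality of the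
    Levy distance. For \<open>x < c + \<delta>\<close> the shifted argument lies below
    \<open>c - \<delta>\<close>, so the left side is negative.\<close>
  have step: "cdf M (x - 2 * \<delta>) - 2 * \<delta> \<le> cdf N x"
    if "real_distribution M" "measure M {x. \<delta> < \<bar>x - c\<bar>} \<le> \<delta>"
      "real_distribution N" "measure N {x. \<delta> < \<bar>x - c\<bar>} \<le> \<delta>" for M N x
  proof (cases "x < c + \<delta>")
    case True
    then have "cdf M (x - 2 * \<delta>) \<le> \<delta>" using that by (intro low) auto
    moreover have "0 \<le> cdf N x" by (simp add: cdf_def)
    ultimately show ?thesis using \<delta> by linarith
  next
    case False
    interpret M: real_distribution M by fact
    have "1 - \<delta> \<le> cdf N x" using that False by (intro high) auto
    moreover have "cdf M (x - 2 * \<delta>) \<le> 1" by (rule M.cdf_bounded_prob)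
    ultimately show ?thesis using \<delta> by linarith
  qed
  let ?S = "{e. 0 < e \<and> (\<forall>x. cdf \<mu> (x - e) - e \<le> cdf \<nu> x \<and> cdf \<nu> x \<le> cdf \<mu> (x + e) + e)}"
  have "cdf \<nu> x \<le> cdf \<mu> (x + 2 * \<delta>) + 2 * \<delta>" for x
    using step[OF \<nu> \<nu>_conc \<mu> \<mu>_conc, of "x + 2 * \<delta>"] by simp
  then have mem: "2 * \<delta> \<in> ?S"
    using step[OF \<mu> \<mu>_conc \<nu> \<nu>_conc] \<delta> by auto
  then show "levy_dist \<mu> \<nu> \<le> 2 * \<delta>"
    unfolding levy_dist_def by (intro cInf_lower bdd_belowI[of _ 0]) auto
  show "0 \<le> levy_dist \<mu> \<nu>"
    unfolding levy_dist_def by (rule cInf_greatest) (use mem in \<open>blast, auto\<close>)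
qed

text \<open>\<open>ennreal\<close> sends negative weights to 0, hence \<open>max 0\<close>. With it
  the formula holds for weights of any sign, which matters for measurability: the importance weights
  are positive only almost surely.\<close>

lemma measure_dirac_mixture:
  assumes "finite I" "A \<in> sets borel"
  shows "measure (dirac_mixture I c p) A = (\<Sum>i\<in>I. max 0 (c i) * indicator A (p i))"
proof -
  have sub: "p -` A \<inter> I \<subseteq> I" by auto
  have "measure (dirac_mixture I c p) A = measure (point_measure I (\<lambda>i. ennreal (c i))) (p -` A \<inter> I)"
    unfolding dirac_mixture_def using assms by (subst measure_distr) (auto simp: space_point_measure)
  also have "\<dots> = enn2real (\<Sum>i\<in>p -` A \<inter> I. ennreal (max 0 (c i)))"
    using assms by (simp add: measure_def emeasure_point_measure_finite2 ennreal_max_0)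
  also have "\<dots> = (\<Sum>i\<in>p -` A \<inter> I. max 0 (c i))"
    by (subst sum_ennreal) (auto intro!: sum_nonneg enn2real_ennreal)
  also have "\<dots> = (\<Sum>i\<in>I. max 0 (c i) * indicator A (p i))"
    using assms by (intro sum.mono_neutral_cong_left) (auto simp: indicator_def)
  finally show ?thesis .
qed

lemma dirac_mixture_atMost_mono:
  assumes "finite I" "x \<le> y"
  shows "measure (dirac_mixture I c p) {-\<infinity><..ereal x} \<le> measure (dirac_mixture I c p) {-\<infinity><..ereal y}"
proof -
  have "measure (dirac_mixture I c p) {-\<infinity><..ereal x} = (\<Sum>i\<in>I. max 0 (c i) * indicator {-\<infinity><..ereal x} (p i))"
    using assms(1) by (rule measure_dirac_mixture) simp
  also have "\<dots> \<le> (\<Sum>i\<in>I. max 0 (c i) * indicator {-\<infinity><..ereal y} (p i))"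
    using assms(2) by (intro sum_mono mult_left_mono) (auto simp: indicator_def intro: order_trans)
  also have "\<dots> = measure (dirac_mixture I c p) {-\<infinity><..ereal y}"
    using assms(1) by (rule measure_dirac_mixture[symmetric]) simp
  finally show ?thesis .
qed

section \<open>Quantiles of finite mixtures of point masses\<close>

lemma Quantile_le:
  assumes "q \<le> measure \<mu> {-\<infinity><..ereal t}"
  shows "Quantile q \<mu> \<le> ereal t"
  unfolding Quantile_def using assms by (intro Inf_lower) auto

lemma le_Quantile:
  assumes "\<And>x. x < t \<Longrightarrow> measure \<mu> {-\<infinity><..ereal x} < q"
  shows "ereal t \<le> Quantile q \<mu>"
  unfolding Quantile_def
proof (rule Inf_greatest, safe)
  fix x assume "q \<le> measure \<mu> {-\<infinity><..ereal x}"
  then show "ereal t \<le> ereal x" using assms[of x] by force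
qed

text \<open>Strictly below \<open>a\<close> the mixture has no mass, and \<open>0 < q\<close>; up to
  \<open>b\<close> it has all its mass, and \<open>q \<le> 1\<close>. The bracket is the same for
  all convex weights, so aggregation weights that are random or vary with the sample sizes do no
  harm.\<close>

lemma Quantile_dirac_mixture_between:
  assumes I: "finite I" and c: "\<And>i. i \<in> I \<Longrightarrow> 0 \<le> c i" "sum c I = 1"
    and q: "0 < q" "q \<le> 1"
    and p: "\<And>i. i \<in> I \<Longrightarrow> p i \<in> {ereal a..ereal b}"
  shows "Quantile q (dirac_mixture I c p) \<in> {ereal a..ereal b}"
proof -
  have "ereal a \<le> Quantile q (dirac_mixture I c p)"
  proof (rule le_Quantile)
    fix x assume "x < a"
    then have "\<not> p i \<le> ereal x" if "i \<in> I" for i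
      using p[OF that] by (auto simp: not_le intro: less_le_trans[of _ "ereal a"])
    then show "measure (dirac_mixture I c p) {-\<infinity><..ereal x} < q"
      using I q by (simp add: measure_dirac_mixture)
  qed
  moreover have "Quantile q (dirac_mixture I c p) \<le> ereal b"
  proof (rule Quantile_le)
    have "measure (dirac_mixture I c p) {-\<infinity><..ereal b} = sum c I"
    proof (subst measure_dirac_mixture[OF I], simp, rule sum.cong[OF refl])
      fix i assume i: "i \<in> I"
      \<comment> \<open>The half-line is open at \<open>-\<infinity>\<close>, so an atom there would
        be missed; the finite bound \<open>a\<close> excludes it.\<close>
      have "-\<infinity> < p i" using p[OF i] by (auto intro: less_le_trans[of _ "ereal a"])
      then show "max 0 (c i) * indicator {-\<infinity><..ereal b} (p i) = c i"
        using c(1)[OF i] p[OF i] by simp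
    qed
    then show "q \<le> measure (dirac_mixture I c p) {-\<infinity><..ereal b}" using c q by simp
  qed
  ultimately show ?thesis by simp
qed

text \<open>Only the values on \<open>I\<close> count. This permits replacing
  \<open>\<omega>_hat\<close> by \<open>\<omega>\<close> when the two are known to agree on
  \<open>space MX\<close> only.\<close>

lemma Quantile_dirac_mixture_cong:
  assumes "finite I" "\<And>i. i \<in> I \<Longrightarrow> c i = c' i" "\<And>i. i \<in> I \<Longrightarrow> p i = p' i"
  shows "Quantile q (dirac_mixture I c p) = Quantile q (dirac_mixture I c' p')"
proof -
  have "measure (dirac_mixture I c p) {-\<infinity><..ereal x} = measure (dirac_mixture I c' p') {-\<infinity><..ereal x}" for x
    using assms by (simp add: measure_dirac_mixture)
  then show ?thesis by (simp add: Quantile_def)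
qed

text \<open>That the quantile is below \<open>y\<close> is an uncountable union over real
  thresholds. The mass of a half-line grows with its end point, so rational thresholds suffice and
  the union becomes countable.\<close>

lemma borel_measurable_Quantile_dirac_mixture:
  assumes I: "finite I"
    and c: "\<And>i. i \<in> I \<Longrightarrow> (\<lambda>\<xi>. c \<xi> i) \<in> borel_measurable N"
    and p: "\<And>i. i \<in> I \<Longrightarrow> (\<lambda>\<xi>. p \<xi> i) \<in> borel_measurable N"
  shows "(\<lambda>\<xi>. Quantile q (dirac_mixture I (c \<xi>) (p \<xi>))) \<in> borel_measurable N"
proof (rule borel_measurableI_less)
  fix y :: ereal
  let ?m = "\<lambda>\<xi> x. measure (dirac_mixture I (c \<xi>) (p \<xi>)) {-\<infinity><..ereal x}"
  have *: "Quantile q (dirac_mixture I (c \<xi>) (p \<xi>)) < y \<longleftrightarrow>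
      (\<exists>r::rat. ereal (of_rat r) < y \<and> q \<le> ?m \<xi> (of_rat r))" for \<xi>
  proof
    assume "Quantile q (dirac_mixture I (c \<xi>) (p \<xi>)) < y"
    then obtain x where x: "q \<le> ?m \<xi> x" "ereal x < y"
      unfolding Quantile_def by (auto simp: Inf_less_iff)
    \<comment> \<open>\<open>y\<close> may be infinite, so a real \<open>z\<close> is put below it
      first; the rational is then found between two reals.\<close>
    obtain z where z: "ereal x < ereal z" "ereal z < y"
      using x(2) ereal_dense2 by blast
    then obtain r where r: "x < of_rat r" "of_rat r < z"
      using of_rat_dense by auto
    have "?m \<xi> x \<le> ?m \<xi> (of_rat r)"
      using r I by (intro dirac_mixture_atMost_mono) auto
    moreover have "ereal (of_rat r) < y" using r z by (meson less_ereal.simps(1) less_trans)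
    ultimately show "\<exists>r::rat. ereal (of_rat r) < y \<and> q \<le> ?m \<xi> (of_rat r)" using x by force
  next
    assume "\<exists>r::rat. ereal (of_rat r) < y \<and> q \<le> ?m \<xi> (of_rat r)"
    then show "Quantile q (dirac_mixture I (c \<xi>) (p \<xi>)) < y"
      using Quantile_le le_less_trans by blast
  qed
  have [measurable]: "(\<lambda>\<xi>. ?m \<xi> x) \<in> borel_measurable N" for x
  proof (subst measure_dirac_mixture[OF I])
    show "(\<lambda>\<xi>. \<Sum>i\<in>I. max 0 (c \<xi> i) * indicator {-\<infinity><..ereal x} (p \<xi> i)) \<in> borel_measurable N"
      using c p by (intro borel_measurable_sum borel_measurable_times borel_measurable_max
          measurable_compose[OF p borel_measurable_indicator]) auto
  qed simp
  show "{\<xi> \<in> space N. Quantile q (dirac_mixture I (c \<xi>) (p \<xi>)) < y} \<in> sets N"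
    unfolding * by measurable
qed

section \<open>Beta laws\<close>

lemma nn_integral_Beta_kernel:
  fixes a b :: real
  assumes "0 < a" "0 < b"
  shows "(\<integral>\<^sup>+x. ennreal (indicator {0<..<1} x * (x powr (a - 1) * (1 - x) powr (b - 1))) \<partial>lborel) = ennreal (Beta a b)"
proof -
  have *: "((\<lambda>x. x powr (a - 1) * (1 - x) powr (b - 1)) has_integral Beta a b) {0<..<1::real}"
    using has_integral_Beta_real[OF assms] by (simp add: has_integral_Icc_iff_Ioo)
  have "((\<lambda>x. indicator {0<..<1} x * (x powr (a - 1) * (1 - x) powr (b - 1))) has_integral Beta a b) UNIV"
    by (rule has_integral_restrict_UNIV[THEN iffD2, OF *, THEN has_integral_eq_rhs, THEN has_integral_cong[THEN iffD1, rotated]])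
       (auto simp: indicator_def)
  then show ?thesis
    by (intro nn_integral_has_integral_lborel) auto
qed

lemma Beta_real_pos:
  fixes a b :: real
  assumes "0 < a" "0 < b"
  shows "0 < Beta a b"
  using assms by (simp add: Beta_def Gamma_real_pos)

lemma prob_space_beta_law:
  assumes "0 < a" "0 < b"
  shows "prob_space (beta_law a b)"
proof
  have B: "0 < Beta a b" using assms by (rule Beta_real_pos)
  have "emeasure (beta_law a b) (space (beta_law a b)) =
      (\<integral>\<^sup>+x. ennreal (1 / Beta a b) * ennreal (indicator {0<..<1} x * (x powr (a - 1) * (1 - x) powr (b - 1))) \<partial>lborel)"
    unfolding beta_law_def using B
    by (simp add: emeasure_density ennreal_mult'[symmetric] mult_ac)
  also have "\<dots> = ennreal (1 / Beta a b) * ennreal (Beta a b)"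
    using assms by (simp add: nn_integral_cmult nn_integral_Beta_kernel)
  also have "\<dots> = 1" using B by (simp add: ennreal_mult'[symmetric])
  finally show "emeasure (beta_law a b) (space (beta_law a b)) = 1" .
qed

text \<open>Multiplying the density by \<open>x ^ m\<close> raises its first parameter from
  \<open>a\<close> to \<open>a + m\<close>, so the moments are ratios of Beta functions.\<close>

lemma has_bochner_integral_beta_law_power:
  assumes "0 < a" "0 < b"
  shows "has_bochner_integral (beta_law a b) (\<lambda>x. x ^ m) (Beta (a + m) b / Beta a b)"
proof -
  have B: "0 < Beta a b" "0 < Beta (a + m) b" using assms by (auto intro!: Beta_real_pos)
  let ?k = "\<lambda>a x. indicator {0<..<1} x * (x powr (a - 1) * (1 - x) powr (b - 1)) :: real"
  have k: "has_bochner_integral lborel (?k (a + m)) (Beta (a + m) b)"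
    using B assms by (intro has_bochner_integral_nn_integral nn_integral_Beta_kernel) auto
  have "has_bochner_integral lborel (\<lambda>x. ?k (a + m) x / Beta a b) (Beta (a + m) b / Beta a b)"
    using k by (rule has_bochner_integral_divide_zero)
  moreover have "?k (a + m) x / Beta a b =
      (indicator {0<..<1} x * x powr (a - 1) * (1 - x) powr (b - 1) / Beta a b) *\<^sub>R x ^ m" for x
    by (auto simp: indicator_def powr_add powr_diff powr_realpow algebra_simps)
  ultimately show ?thesis
    unfolding beta_law_def using B
    by (intro has_bochner_integral_density) auto
qed

text \<open>Chebyshev's inequality around the mean \<open>a / (a + b)\<close>, with the variance
  bounded through \<open>4 * (a * b) \<le> (a + b)\<^sup>2\<close>. Only \<open>a + b\<close> enters
  the bound, and in the application this is the effective sample size plus one.\<close>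

lemma beta_law_concentration:
  assumes ab: "0 < a" "0 < b" and \<delta>: "0 < \<delta>"
  shows "measure (beta_law a b) {x. \<delta> < \<bar>x - a / (a + b)\<bar>} \<le> 1 / (4 * (a + b) * \<delta>\<^sup>2)"
proof -
  interpret prob_space "beta_law a b" using ab by (rule prob_space_beta_law)
  have sets[measurable_cong]: "sets (beta_law a b) = sets borel" by (simp add: beta_law_def)
  have space: "space (beta_law a b) = UNIV" by (simp add: beta_law_def)
  have B: "0 < Beta a b" using ab by (rule Beta_real_pos)
  \<comment> \<open>The recurrence for \<open>Beta\<close> in its first argument requires that this
    argument is not a pole of the Gamma function.\<close>
  have not_pole: "x \<notin> \<int>\<^sub>\<le>\<^sub>0" if "0 < x" for x :: real using that by (auto elim!: nonpos_Ints_cases)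
  have B1: "Beta (a + 1) b = a / (a + b) * Beta a b"
    using Beta_plus1_left[of a b] not_pole[of a] ab by (simp add: field_simps)
  have "Beta ((a + 1) + 1) b = (a + 1) / (a + 1 + b) * Beta (a + 1) b"
    using Beta_plus1_left[of "a + 1" b] not_pole[of "a + 1"] ab by (simp add: field_simps)
  moreover have "a + 1 + 1 = a + 2" by simp
  ultimately have B2: "Beta (a + 2) b = (a + 1) / (a + 1 + b) * (a / (a + b)) * Beta a b"
    by (simp only: B1 mult.assoc)
  have m1: "has_bochner_integral (beta_law a b) (\<lambda>x. x) (a / (a + b))"
    using has_bochner_integral_beta_law_power[OF ab, of 1] B by (simp add: B1)
  have m2: "has_bochner_integral (beta_law a b) (\<lambda>x. x\<^sup>2) ((a + 1) / (a + 1 + b) * (a / (a + b)))"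
    using has_bochner_integral_beta_law_power[OF ab, of 2] B by (simp add: B2)
  have E: "expectation (\<lambda>x. x) = a / (a + b)" using m1 by (rule has_bochner_integral_integral_eq)
  have V: "variance (\<lambda>x. x) \<le> 1 / (4 * (a + b))"
  proof -
    have "variance (\<lambda>x. x) = (a + 1) / (a + 1 + b) * (a / (a + b)) - (a / (a + b))\<^sup>2"
      using m1 m2 by (subst variance_eq) (auto simp: has_bochner_integral_iff)
    also have "\<dots> = a * b / ((a + b)\<^sup>2 * (a + b + 1))"
    proof -
      have nz: "a + b \<noteq> 0" "a + b + 1 \<noteq> 0" "a + 1 + b \<noteq> 0" using ab by auto
      show ?thesis using nz by (simp add: divide_simps power2_eq_square) algebra
    qed
    also have "\<dots> \<le> ((a + b)\<^sup>2 / 4) / ((a + b)\<^sup>2 * (a + b))"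
    proof (rule frac_le)
      have "4 * (a * b) = (a + b)\<^sup>2 - (a - b)\<^sup>2" by (simp add: power2_eq_square algebra_simps)
      also have "\<dots> \<le> (a + b)\<^sup>2" by simp
      finally show "a * b \<le> (a + b)\<^sup>2 / 4" by simp
    qed (use ab in \<open>auto intro!: mult_left_mono\<close>)
    also have "\<dots> = 1 / (4 * (a + b))"
    proof -
      have "(c\<^sup>2 / 4) / (c\<^sup>2 * c) = 1 / (4 * c)" if "0 < c" for c :: real
        using that by (simp add: field_simps)
      then show ?thesis using ab by simp
    qed
    finally show ?thesis .
  qed
  have "prob {x. \<delta> < \<bar>x - a / (a + b)\<bar>} \<le> prob {x \<in> space (beta_law a b). \<delta> \<le> \<bar>x - expectation (\<lambda>x. x)\<bar>}"
    by (intro finite_measure_mono) (auto simp: E space)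
  also have "\<dots> \<le> variance (\<lambda>x. x) / \<delta>\<^sup>2"
    using m2 \<delta> by (intro Chebyshev_inequality) (auto simp: has_bochner_integral_iff)
  also have "\<dots> \<le> 1 / (4 * (a + b)) / \<delta>\<^sup>2"
    using V by (intro divide_right_mono) auto
  finally show ?thesis by simp
qed

section \<open>Joint laws under covariate shift\<close>

context
  fixes MX :: "'x measure" and MY :: "'y measure" and \<mu> :: "'x measure" and \<kappa> :: "'x \<Rightarrow> 'y measure"
  assumes \<mu>: "\<mu> \<in> space (prob_algebra MX)" and \<kappa>: "\<kappa> \<in> MX \<rightarrow>\<^sub>M prob_algebra MY"
begin

lemma measurable_joint_law_kernel:
  "(\<lambda>x. distr (\<kappa> x) (MX \<Otimes>\<^sub>M MY) (Pair x)) \<in> MX \<rightarrow>\<^sub>M prob_algebra (MX \<Otimes>\<^sub>M MY)"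
  using \<kappa> by (rule measurable_distr_prob_space2) simp

lemma prob_space_joint_law: "prob_space (joint_law MX MY \<mu> \<kappa>)"
  unfolding joint_law_def by (rule prob_space_bind'[OF \<mu> measurable_joint_law_kernel])

lemma sets_joint_law [measurable_cong]: "sets (joint_law MX MY \<mu> \<kappa>) = sets (MX \<Otimes>\<^sub>M MY)"
  unfolding joint_law_def by (rule sets_bind'[OF \<mu> measurable_joint_law_kernel])

text \<open>Integration over the label given the covariate, then over the covariate. The marginal
  and the density of a joint law are both derived from this formula.\<close>

lemma nn_integral_joint_law:
  assumes f [measurable]: "f \<in> borel_measurable (MX \<Otimes>\<^sub>M MY)"
  shows "(\<integral>\<^sup>+z. f z \<partial>joint_law MX MY \<mu> \<kappa>) = (\<integral>\<^sup>+x. \<integral>\<^sup>+y. f (x, y) \<partial>\<kappa> x \<partial>\<mu>)"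
proof -
  have sets: "sets \<mu> = sets MX" and space: "space \<mu> = space MX"
    using \<mu> by (auto simp: space_prob_algebra dest: sets_eq_imp_space_eq)
  have "(\<lambda>x. distr (\<kappa> x) (MX \<Otimes>\<^sub>M MY) (Pair x)) \<in> \<mu> \<rightarrow>\<^sub>M subprob_algebra (MX \<Otimes>\<^sub>M MY)"
    using measurable_prob_algebraD[OF measurable_joint_law_kernel] sets
    by (simp cong: measurable_cong_sets)
  then have "(\<integral>\<^sup>+z. f z \<partial>joint_law MX MY \<mu> \<kappa>) =
      (\<integral>\<^sup>+x. \<integral>\<^sup>+z. f z \<partial>distr (\<kappa> x) (MX \<Otimes>\<^sub>M MY) (Pair x) \<partial>\<mu>)"
    unfolding joint_law_def by (rule nn_integral_bind[OF f])
  also have "\<dots> = (\<integral>\<^sup>+x. \<integral>\<^sup>+y. f (x, y) \<partial>\<kappa> x \<partial>\<mu>)"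
  proof (rule nn_integral_cong)
    fix x assume "x \<in> space \<mu>"
    then have x: "x \<in> space MX" by (simp add: space)
    then have "sets (\<kappa> x) = sets MY"
      using measurable_space[OF \<kappa>] by (auto simp: space_prob_algebra)
    then have "Pair x \<in> \<kappa> x \<rightarrow>\<^sub>M MX \<Otimes>\<^sub>M MY"
      using x by (simp cong: measurable_cong_sets)
    then show "(\<integral>\<^sup>+z. f z \<partial>distr (\<kappa> x) (MX \<Otimes>\<^sub>M MY) (Pair x)) = (\<integral>\<^sup>+y. f (x, y) \<partial>\<kappa> x)"
      using nn_integral_distr[of "Pair x" "\<kappa> x" "MX \<Otimes>\<^sub>M MY" f] f by simp
  qed
  finally show ?thesis .
qed

lemma distr_fst_joint_law: "distr (joint_law MX MY \<mu> \<kappa>) MX fst = \<mu>"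
proof (rule measure_eqI)
  show "sets (distr (joint_law MX MY \<mu> \<kappa>) MX fst) = sets \<mu>"
    using \<mu> by (simp add: space_prob_algebra)
  fix C assume "C \<in> sets (distr (joint_law MX MY \<mu> \<kappa>) MX fst)"
  then have C [measurable]: "C \<in> sets MX" by simp
  have sets: "sets \<mu> = sets MX" and space: "space \<mu> = space MX"
    using \<mu> by (auto simp: space_prob_algebra dest: sets_eq_imp_space_eq)
  have "emeasure (distr (joint_law MX MY \<mu> \<kappa>) MX fst) C =
      (\<integral>\<^sup>+x. indicator C x \<partial>distr (joint_law MX MY \<mu> \<kappa>) MX fst)"
    by simp
  also have "\<dots> = (\<integral>\<^sup>+z. indicator C (fst z) \<partial>joint_law MX MY \<mu> \<kappa>)"
    by (rule nn_integral_distr) measurable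
  also have "\<dots> = (\<integral>\<^sup>+x. \<integral>\<^sup>+y. indicator C x \<partial>\<kappa> x \<partial>\<mu>)"
    by (subst nn_integral_joint_law) auto
  also have "\<dots> = (\<integral>\<^sup>+x. indicator C x \<partial>\<mu>)"
  proof (rule nn_integral_cong)
    fix x assume "x \<in> space \<mu>"
    then have "prob_space (\<kappa> x)"
      using measurable_space[OF \<kappa>] by (auto simp: space_prob_algebra space)
    then show "(\<integral>\<^sup>+y. indicator C x \<partial>\<kappa> x) = indicator C x"
      by (simp add: prob_space.emeasure_space_1)
  qed
  also have "\<dots> = emeasure \<mu> C" using sets by simp
  finally show "emeasure (distr (joint_law MX MY \<mu> \<kappa>) MX fst) C = emeasure \<mu> C" .
qed

lemma AE_joint_law_fst:
  assumes "AE x in \<mu>. Q x" "{x \<in> space MX. Q x} \<in> sets MX"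
  shows "AE z in joint_law MX MY \<mu> \<kappa>. Q (fst z)"
proof -
  have "AE x in distr (joint_law MX MY \<mu> \<kappa>) MX fst. Q x"
    using assms(1) unfolding distr_fst_joint_law .
  then show ?thesis using assms(2) by (subst (asm) AE_distr_iff) auto
qed

end

text \<open>This is where covariate shift enters: the kernel is shared, so the density of the
  marginals can be pulled into the inner integral and becomes a density of the joint laws that
  depends on the covariate alone.\<close>

lemma joint_law_density:
  assumes \<mu>: "\<mu> \<in> space (prob_algebra MX)" and \<nu>: "\<nu> \<in> space (prob_algebra MX)"
    and \<kappa>: "\<kappa> \<in> MX \<rightarrow>\<^sub>M prob_algebra MY"
    and g [measurable]: "g \<in> borel_measurable MX" and eq: "\<nu> = density \<mu> g"
  shows "joint_law MX MY \<nu> \<kappa> = density (joint_law MX MY \<mu> \<kappa>) (\<lambda>z. g (fst z))"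
proof (rule measure_eqI)
  note [measurable_cong] = sets_joint_law[OF \<mu> \<kappa>] sets_joint_law[OF \<nu> \<kappa>]
  show "sets (joint_law MX MY \<nu> \<kappa>) = sets (density (joint_law MX MY \<mu> \<kappa>) (\<lambda>z. g (fst z)))"
    by (simp add: sets_joint_law[OF \<mu> \<kappa>] sets_joint_law[OF \<nu> \<kappa>])
  fix C assume "C \<in> sets (joint_law MX MY \<nu> \<kappa>)"
  then have C [measurable]: "C \<in> sets (MX \<Otimes>\<^sub>M MY)" by (simp add: sets_joint_law[OF \<nu> \<kappa>])
  have sets [measurable_cong]: "sets \<mu> = sets MX" and space: "space \<mu> = space MX"
    using \<mu> by (auto simp: space_prob_algebra dest: sets_eq_imp_space_eq)
  have \<kappa>' [measurable]: "\<kappa> \<in> MX \<rightarrow>\<^sub>M subprob_algebra MY"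
    using \<kappa> by (rule measurable_prob_algebraD)
  have inner: "(\<lambda>x. \<integral>\<^sup>+y. indicator C (x, y) \<partial>\<kappa> x) \<in> borel_measurable MX"
    by (rule nn_integral_measurable_subprob_algebra2[where N = MY]) (use \<kappa>' C in \<open>simp_all add: case_prod_beta'\<close>)
  have sets\<kappa>: "sets (\<kappa> x) = sets MY" if "x \<in> space MX" for x
    using measurable_space[OF \<kappa> that] by (auto simp: space_prob_algebra)
  have "emeasure (joint_law MX MY \<nu> \<kappa>) C = (\<integral>\<^sup>+z. indicator C z \<partial>joint_law MX MY \<nu> \<kappa>)"
    by (simp add: sets_joint_law[OF \<nu> \<kappa>])
  also have "\<dots> = (\<integral>\<^sup>+x. \<integral>\<^sup>+y. indicator C (x, y) \<partial>\<kappa> x \<partial>density \<mu> g)"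
    by (subst nn_integral_joint_law[OF \<nu> \<kappa>]) (auto simp: eq)
  also have "\<dots> = (\<integral>\<^sup>+x. g x * (\<integral>\<^sup>+y. indicator C (x, y) \<partial>\<kappa> x) \<partial>\<mu>)"
    by (rule nn_integral_density)
      (use g sets inner in \<open>simp_all cong: measurable_cong_sets\<close>)
  also have "\<dots> = (\<integral>\<^sup>+x. \<integral>\<^sup>+y. g x * indicator C (x, y) \<partial>\<kappa> x \<partial>\<mu>)"
  proof (rule nn_integral_cong)
    fix x assume "x \<in> space \<mu>"
    then have x [measurable]: "x \<in> space MX" by (simp add: space)
    have "(\<lambda>y. indicator C (x, y) :: ennreal) \<in> borel_measurable (\<kappa> x)"
      by (subst measurable_cong_sets[OF sets\<kappa>[OF x] refl]) measurable
    then show "g x * (\<integral>\<^sup>+y. indicator C (x, y) \<partial>\<kappa> x) = (\<integral>\<^sup>+y. g x * indicator C (x, y) \<partial>\<kappa> x)"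
      by (rule nn_integral_cmult[symmetric])
  qed
  also have "\<dots> = (\<integral>\<^sup>+z. g (fst z) * indicator C z \<partial>joint_law MX MY \<mu> \<kappa>)"
    by (subst nn_integral_joint_law[OF \<mu> \<kappa>]) auto
  also have "\<dots> = emeasure (density (joint_law MX MY \<mu> \<kappa>) (\<lambda>z. g (fst z))) C"
    by (rule emeasure_density[symmetric]) measurable
  finally show "emeasure (joint_law MX MY \<nu> \<kappa>) C =
      emeasure (density (joint_law MX MY \<mu> \<kappa>) (\<lambda>z. g (fst z))) C" .
qed

text \<open>Absolute continuity is assumed of the joint laws, while \<open>\<omega>\<close> is a
  Radon-Nikodym derivative of marginals. A null set of covariates is transferred through its
  preimage under \<open>fst\<close>.\<close>

lemma absolutely_continuous_marginal:
  assumes \<mu>: "\<mu> \<in> space (prob_algebra MX)" and \<nu>: "\<nu> \<in> space (prob_algebra MX)"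
    and \<kappa>: "\<kappa> \<in> MX \<rightarrow>\<^sub>M prob_algebra MY"
    and ac: "absolutely_continuous (joint_law MX MY \<mu> \<kappa>) (joint_law MX MY \<nu> \<kappa>)"
  shows "absolutely_continuous \<mu> \<nu>"
  unfolding absolutely_continuous_def
proof
  note [measurable_cong] = sets_joint_law[OF \<mu> \<kappa>] sets_joint_law[OF \<nu> \<kappa>]
  have meas: "fst \<in> joint_law MX MY \<mu> \<kappa> \<rightarrow>\<^sub>M MX" "fst \<in> joint_law MX MY \<nu> \<kappa> \<rightarrow>\<^sub>M MX"
    by measurable
  have space: "space (joint_law MX MY \<mu> \<kappa>) = space (joint_law MX MY \<nu> \<kappa>)"
    by (rule sets_eq_imp_space_eq) (simp add: sets_joint_law[OF \<mu> \<kappa>] sets_joint_law[OF \<nu> \<kappa>])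
  fix N assume "N \<in> null_sets \<mu>"
  then have "N \<in> null_sets (distr (joint_law MX MY \<mu> \<kappa>) MX fst)"
    by (simp add: distr_fst_joint_law[OF \<mu> \<kappa>])
  then have "fst -` N \<inter> space (joint_law MX MY \<mu> \<kappa>) \<in> null_sets (joint_law MX MY \<mu> \<kappa>)" "N \<in> sets MX"
    using meas by (auto simp: null_sets_distr_iff)
  then have "N \<in> null_sets (distr (joint_law MX MY \<nu> \<kappa>) MX fst)"
    using ac meas by (auto simp: null_sets_distr_iff absolutely_continuous_def space)
  then show "N \<in> null_sets \<nu>"
    by (simp add: distr_fst_joint_law[OF \<nu> \<kappa>])
qed

section \<open>Conditioning and concentration\<close>

context prob_space
begin

lemma finite_measure_subalgebra_vimage:
  assumes "D \<in> M \<rightarrow>\<^sub>M S"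
  shows "finite_measure_subalgebra M (vimage_algebra (space M) D S)"
proof
  show "subalgebra M (vimage_algebra (space M) D S)"
    using assms measurable_iff_sets[of D M S] by (auto simp: subalgebra_def)
qed

text \<open>The constant satisfies the defining property of a conditional expectation: every event
  of the generated algebra is a preimage under \<open>D\<close>, on which independence factorises
  the probability.\<close>

lemma prob_given_independent:
  assumes indep: "independent_rvs M S D T X" and C: "C \<in> sets T"
  shows "AE \<xi> in M. prob_given M S D {\<xi> \<in> space M. X \<xi> \<in> C} \<xi> = prob {\<xi> \<in> space M. X \<xi> \<in> C}"
proof -
  have [measurable]: "D \<in> M \<rightarrow>\<^sub>M S" "X \<in> M \<rightarrow>\<^sub>M T"
    using indep by (auto simp: independent_rvs_def)
  interpret D: finite_measure_subalgebra M "vimage_algebra (space M) D S"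
    by (rule finite_measure_subalgebra_vimage) measurable
  let ?X = "{\<xi> \<in> space M. X \<xi> \<in> C}"
  have X [measurable]: "?X \<in> events" using C by measurable
  show ?thesis
    unfolding prob_given_def
  proof (rule D.real_cond_exp_charact)
    fix H assume "H \<in> sets (vimage_algebra (space M) D S)"
    moreover have "D \<in> space M \<rightarrow> space S" by (rule measurable_space[THEN funcsetI]) auto
    ultimately obtain C' where C': "C' \<in> sets S" "H = D -` C' \<inter> space M"
      by (auto simp: sets_vimage_algebra2)
    then have H [measurable]: "H \<in> events" by simp
    have "prob (H \<inter> ?X) = prob H * prob ?X"
    proof -
      have "?X = X -` C \<inter> space M" by auto
      then show ?thesis
        using indep C C' unfolding independent_rvs_def by (auto elim!: indep_setD)
    qed
    then show "(\<integral>\<xi>\<in>H. indicator ?X \<xi> \<partial>M) = (\<integral>\<xi>\<in>H. prob ?X \<partial>M)"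
      unfolding set_lebesgue_integral_def
      by (simp add: indicator_inter_arith[symmetric] mult.commute)
  qed (use X in \<open>auto intro!: integrable_real_indicator simp: emeasure_eq_measure\<close>)
qed

text \<open>\<open>E\<close> depends on data and test point together. Once the data lie in
  \<open>G\<close>, it is caught between two events about the test point alone, whose conditional
  probabilities are constants by independence. The indicator of \<open>G\<close> is a function of
  the data and so factors out of the conditional expectation.\<close>

lemma prob_given_between:
  assumes indep: "independent_rvs M S D T X"
    and G: "G \<in> sets S" and C: "C\<^sub>1 \<in> sets T" "C\<^sub>2 \<in> sets T" and E: "E \<in> events"
    and low: "AE \<xi> in M. D \<xi> \<in> G \<longrightarrow> X \<xi> \<in> C\<^sub>1 \<longrightarrow> \<xi> \<in> E"
    and high: "AE \<xi> in M. D \<xi> \<in> G \<longrightarrow> \<xi> \<in> E \<longrightarrow> X \<xi> \<in> C\<^sub>2"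
  shows "AE \<xi> in M. D \<xi> \<in> G \<longrightarrow>
    prob_given M S D E \<xi> \<in> {prob {\<xi> \<in> space M. X \<xi> \<in> C\<^sub>1}..prob {\<xi> \<in> space M. X \<xi> \<in> C\<^sub>2}}"
proof -
  have [measurable]: "D \<in> M \<rightarrow>\<^sub>M S" "X \<in> M \<rightarrow>\<^sub>M T"
    using indep by (auto simp: independent_rvs_def)
  note [measurable] = G C E
  interpret D: finite_measure_subalgebra M "vimage_algebra (space M) D S"
    by (rule finite_measure_subalgebra_vimage) measurable
  let ?F = "vimage_algebra (space M) D S"
  let ?g = "\<lambda>\<xi>. indicator G (D \<xi>) :: real"
  let ?h = "\<lambda>C \<xi>. indicator {\<xi> \<in> space M. X \<xi> \<in> C} \<xi> :: real"
  have "D \<in> ?F \<rightarrow>\<^sub>M S"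
    by (rule measurable_vimage_algebra1) (rule measurable_space[THEN funcsetI], auto)
  then have g: "?g \<in> borel_measurable ?F" by measurable
  have g' [measurable]: "?g \<in> borel_measurable M" by measurable
  have h [measurable]: "?h C' \<in> borel_measurable M" if "C' \<in> sets T" for C'
    using that by measurable
  have int1: "integrable M (\<lambda>\<xi>. ?g \<xi> * ?h C\<^sub>1 \<xi>)"
    using h C g' by (intro integrable_const_bound[where B = 1]) (auto simp: indicator_def)
  have int2: "integrable M (\<lambda>\<xi>. ?g \<xi> * indicator E \<xi>)"
    using g' E by (intro integrable_const_bound[where B = 1]) (auto simp: indicator_def)
  have intX: "integrable M (?h C\<^sub>2)"
    using C h by (intro integrable_const_bound[where B = 1]) (auto simp: indicator_def)
  have intE: "integrable M (indicator E :: _ \<Rightarrow> real)"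
    using E by (auto intro!: integrable_real_indicator simp: emeasure_eq_measure)
  \<comment> \<open>Off \<open>G\<close> the product with \<open>?g\<close> is 0, so the inclusions
    assumed on \<open>G\<close> become inequalities between indicators almost everywhere, and
    monotonicity of conditional expectation applies.\<close>
  have "AE \<xi> in M. real_cond_exp M ?F (\<lambda>\<xi>. ?g \<xi> * ?h C\<^sub>1 \<xi>) \<xi> \<le> real_cond_exp M ?F (indicator E) \<xi>"
    by (rule D.real_cond_exp_mono[OF _ int1 intE]) (use low in \<open>auto simp: indicator_def\<close>)
  moreover have "AE \<xi> in M. real_cond_exp M ?F (\<lambda>\<xi>. ?g \<xi> * ?h C\<^sub>1 \<xi>) \<xi> = ?g \<xi> * real_cond_exp M ?F (?h C\<^sub>1) \<xi>"
    using int1 C by (intro D.real_cond_exp_mult g) auto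
  moreover have "AE \<xi> in M. real_cond_exp M ?F (\<lambda>\<xi>. ?g \<xi> * indicator E \<xi>) \<xi> \<le> real_cond_exp M ?F (?h C\<^sub>2) \<xi>"
    by (rule D.real_cond_exp_mono[OF _ int2 intX]) (use high in \<open>auto simp: indicator_def\<close>)
  moreover have "AE \<xi> in M. real_cond_exp M ?F (\<lambda>\<xi>. ?g \<xi> * indicator E \<xi>) \<xi> = ?g \<xi> * real_cond_exp M ?F (indicator E) \<xi>"
    using int2 by (intro D.real_cond_exp_mult g) auto
  moreover note prob_given_independent[OF indep C(1)] prob_given_independent[OF indep C(2)]
  ultimately show ?thesis
    unfolding prob_given_def by eventually_elim auto
qed

text \<open>Averaging the conditional probability gives the probability. This removes the
  conditioning for the Beta laws, whose parameters are functions of the data.\<close>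

lemma prob_le_of_prob_given_le:
  assumes D: "D \<in> M \<rightarrow>\<^sub>M S" and E: "E \<in> events" and le: "AE \<xi> in M. prob_given M S D E \<xi> \<le> c"
  shows "prob E \<le> c"
proof -
  interpret D: finite_measure_subalgebra M "vimage_algebra (space M) D S"
    using D by (rule finite_measure_subalgebra_vimage)
  have int: "integrable M (indicator E :: _ \<Rightarrow> real)"
    using E by (auto intro!: integrable_real_indicator simp: emeasure_eq_measure)
  have "prob E = expectation (prob_given M S D E)"
    unfolding prob_given_def using D.real_cond_exp_int(2)[OF int] E by simp
  also have "\<dots> \<le> expectation (\<lambda>_. c)"
    using le D.real_cond_exp_int(1)[OF int] by (intro integral_mono_AE) (auto simp: prob_given_def)
  finally show ?thesis by (simp add: prob_space)
qed

text \<open>Hoeffding's inequality, with the common mean written as an integral over the law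
  \<open>P\<close>, where the importance weighting can evaluate it.\<close>

lemma iid_mean_concentration:
  fixes \<eta> B :: real
  assumes I: "finite I" "I \<noteq> {}" and indep: "indep_vars (\<lambda>_. T) Z I"
    and law: "\<And>i. i \<in> I \<Longrightarrow> distr M T (Z i) = P"
    and h [measurable]: "h \<in> borel_measurable T" and bounds: "AE z in P. h z \<in> {0..B}"
    and B: "0 < B" and \<eta>: "0 \<le> \<eta>"
  shows "prob {\<xi> \<in> space M. \<bar>(\<Sum>i\<in>I. h (Z i \<xi>)) - card I * integral\<^sup>L P h\<bar> \<ge> \<eta> * card I}
    \<le> 2 * exp (- 2 * card I * \<eta>\<^sup>2 / B\<^sup>2)"
proof -
  have Z [measurable]: "Z i \<in> M \<rightarrow>\<^sub>M T" if "i \<in> I" for i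
    using indep that by (auto simp: indep_vars_def)
  have E: "expectation (\<lambda>\<xi>. h (Z i \<xi>)) = integral\<^sup>L P h" if "i \<in> I" for i
    using that law[OF that, symmetric] by (simp add: integral_distr)
  interpret H: Hoeffding_ineq M I "\<lambda>i \<xi>. h (Z i \<xi>)" "\<lambda>_. 0" "\<lambda>_. B" "card I * integral\<^sup>L P h"
  proof unfold_locales
    show "indep_vars (\<lambda>_. borel) (\<lambda>i \<xi>. h (Z i \<xi>)) I"
      using indep by (rule indep_vars_compose2) simp
    fix i assume i: "i \<in> I"
    have "{z \<in> space T. h z \<in> {0..B}} \<in> sets T" by measurable
    then show "AE \<xi> in M. h (Z i \<xi>) \<in> {0..B}"
      using bounds Z[OF i] unfolding law[OF i, symmetric] by (subst (asm) AE_distr_iff) auto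
  next
    show "card I * integral\<^sup>L P h \<equiv> \<Sum>i\<in>I. expectation (\<lambda>\<xi>. h (Z i \<xi>))"
      using E by (intro eq_reflection) simp
  qed (use I in auto)
  have pos: "0 < card I" using I by (simp add: card_gt_0_iff)
  have "prob {\<xi> \<in> space M. \<bar>(\<Sum>i\<in>I. h (Z i \<xi>)) - card I * integral\<^sup>L P h\<bar> \<ge> \<eta> * card I}
      \<le> 2 * exp (-2 * (\<eta> * card I)\<^sup>2 / (\<Sum>i\<in>I. (B - 0)\<^sup>2))"
    using \<eta> B pos by (intro H.Hoeffding_ineq_abs_ge) auto
  \<comment> \<open>The squared deviation has a factor \<open>(card I)\<^sup>2\<close> and the
    squared ranges add up to \<open>card I * B\<^sup>2\<close>, so one factor \<open>card I\<close>
    survives in the exponent.\<close>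
  also have "-2 * (\<eta> * card I)\<^sup>2 / (\<Sum>i\<in>I. (B - 0)\<^sup>2) = - 2 * card I * \<eta>\<^sup>2 / B\<^sup>2"
    using pos B by (simp add: field_simps power2_eq_square)
  finally show ?thesis .
qed

end

section \<open>Deterministic bracketing of one agent's quantile\<close>

text \<open>The unnormalised importance-weighted empirical measure. For measurable \<open>C\<close>
  its mean under the data is \<open>n k\<close> times the test probability of
  \<open>C\<close>.\<close>

definition weight_mass ::
    "(nat \<Rightarrow> 'x \<Rightarrow> real) \<Rightarrow> (nat \<Rightarrow> nat) \<Rightarrow> (nat \<times> nat \<Rightarrow> 'x \<times> 'y) \<Rightarrow> nat \<Rightarrow> ('x \<times> 'y) set \<Rightarrow> real" where
  "weight_mass \<omega> n d k C = (\<Sum>i=1..n k. \<omega> k (fst (d (k, i))) * indicator C (d (k, i)))"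

text \<open>The mass up to the lower or upper threshold is compared with \<open>1 - \<beta>\<close>
  times the total weight. Sampling errors cost \<open>\<epsilon> / 4\<close> in the numerator and at
  most \<open>\<epsilon> / 4\<close> in the denominator, the test weight at most
  \<open>\<epsilon> / 2\<close>: together no more than the margin \<open>\<epsilon>\<close>.\<close>

lemma agent_quantile_between:
  fixes d :: "nat \<times> nat \<Rightarrow> 'x \<times> 'y" and s :: "'x \<times> 'y \<Rightarrow> real"
    and \<omega> :: "nat \<Rightarrow> 'x \<Rightarrow> real" and n :: "nat \<Rightarrow> nat" and k :: nat
    and W :: "('x \<times> 'y) set \<Rightarrow> real"
    and A B \<beta> \<epsilon> t\<^sub>1 t\<^sub>2 :: real
  defines "W \<equiv> weight_mass \<omega> n d k"
  assumes A: "0 < A" and \<beta>: "0 < \<beta>" "\<beta> < 1" and \<epsilon>: "0 < \<epsilon>" "\<epsilon> < 1"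
    and weights: "\<And>i. i \<in> {1..n k} \<Longrightarrow> \<omega> k (fst (d (k, i))) \<in> {A..B}" "\<omega> k x \<in> {A..B}"
    and total: "\<bar>W UNIV - n k\<bar> \<le> \<epsilon> / 4 * n k"
    and low: "\<bar>W {z. s z \<le> t\<^sub>1} - n k * (1 - \<beta> - \<epsilon>)\<bar> \<le> \<epsilon> / 4 * n k"
    and high: "\<bar>W {z. s z \<le> t\<^sub>2} - n k * (1 - \<beta> + \<epsilon>)\<bar> \<le> \<epsilon> / 4 * n k"
    and n: "B \<le> \<epsilon> / 2 * n k"
  shows "agent_quantile s \<omega> n d \<beta> k x \<in> {ereal t\<^sub>1..ereal t\<^sub>2}"
proof -
  let ?S = "\<Sum>j=1..n k. \<omega> k (fst (d (k, j)))"
  let ?c = "\<lambda>i. (if i = 0 then \<omega> k x else \<omega> k (fst (d (k, i)))) / (?S + \<omega> k x)"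
  let ?p = "\<lambda>i. if i = 0 then \<infinity> else ereal (s (d (k, i)))"
  have S: "W UNIV = ?S" by (simp add: W_def weight_mass_def)
  have \<omega>x: "0 < \<omega> k x" "\<omega> k x \<le> B" using weights(2) A by auto
  have nk: "0 < real (n k)"
  proof (rule ccontr)
    assume "\<not> 0 < real (n k)"
    then show False using n \<omega>x by simp
  qed
  have "\<epsilon> * n k < 1 * real (n k)" using nk \<epsilon> by (intro mult_strict_right_mono) auto
  then have Spos: "0 < ?S" using total nk unfolding S abs_le_iff by linarith
  have mass: "measure (dirac_mixture {0..n k} ?c ?p) {-\<infinity><..ereal t} = W {z. s z \<le> t} / (?S + \<omega> k x)" for t
  proof -
    have "measure (dirac_mixture {0..n k} ?c ?p) {-\<infinity><..ereal t} =
        (\<Sum>i\<in>{0..n k}. max 0 (?c i) * indicator {-\<infinity><..ereal t} (?p i))"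
      by (rule measure_dirac_mixture) auto
    \<comment> \<open>Index 0 drops out: its atom sits at \<open>\<infinity>\<close>, beyond every
      finite \<open>t\<close>. Its weight survives only in the denominator.\<close>
    also have "\<dots> = (\<Sum>i\<in>{1..n k}. max 0 (?c i) * indicator {-\<infinity><..ereal t} (?p i))"
      by (rule sum.mono_neutral_right) auto
    also have "\<dots> = (\<Sum>i\<in>{1..n k}. \<omega> k (fst (d (k, i))) * indicator {z. s z \<le> t} (d (k, i)) / (?S + \<omega> k x))"
    proof (rule sum.cong[OF refl])
      fix i assume i: "i \<in> {1..n k}"
      have "0 \<le> \<omega> k (fst (d (k, i)))" using weights(1)[OF i] A by auto
      then show "max 0 (?c i) * indicator {-\<infinity><..ereal t} (?p i) =
          \<omega> k (fst (d (k, i))) * indicator {z. s z \<le> t} (d (k, i)) / (?S + \<omega> k x)"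
        using i Spos \<omega>x by (auto simp: indicator_def max_def)
    qed
    also have "\<dots> = W {z. s z \<le> t} / (?S + \<omega> k x)"
      by (simp only: W_def weight_mass_def sum_divide_distrib)
    finally show ?thesis .
  qed
  \<comment> \<open>With these names all bounds are linear in \<open>N\<close>, \<open>e\<close> and
    a few products with \<open>q\<close>, which \<open>linarith\<close> treats as atoms.\<close>
  define N e q where "N = real (n k)" and "e = \<epsilon> * N" and "q = 1 - \<beta>"
  note defs = N_def e_def q_def
  have q: "0 < q" "q < 1" and e: "0 < e" using \<beta> \<epsilon> nk by (auto simp: defs)
  have qe: "q * e < e" using q e by simp
  have S': "N - e / 4 \<le> ?S" "?S \<le> N + e / 4"
    using total unfolding S abs_le_iff by (auto simp: defs)
  have "n k * (1 - \<beta> - \<epsilon>) = q * N - e" "n k * (1 - \<beta> + \<epsilon>) = q * N + e" "\<epsilon> / 4 * n k = e / 4"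
    by (auto simp: defs algebra_simps)
  then have W: "W {z. s z \<le> t\<^sub>1} \<le> q * N - e + e / 4" "q * N + e - e / 4 \<le> W {z. s z \<le> t\<^sub>2}"
    using low high unfolding abs_le_iff by linarith+
  \<comment> \<open>At the lower threshold the test weight only enlarges the denominator, so its
    positivity is enough.\<close>
  have "q * (N - e / 4) \<le> q * ?S" "0 < q * \<omega> k x"
    using S' q \<omega>x by (auto intro: mult_left_mono)
  then have "W {z. s z \<le> t\<^sub>1} < q * (?S + \<omega> k x)"
    using W(1) qe e unfolding right_diff_distrib distrib_left by linarith
  then have lt: "W {z. s z \<le> t\<^sub>1} / (?S + \<omega> k x) < 1 - \<beta>"
    using Spos \<omega>x by (simp add: pos_divide_less_eq q_def)
  have "q * ?S \<le> q * (N + e / 4)"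
    using S' q by (intro mult_left_mono) auto
  \<comment> \<open>At the upper threshold the test weight works against the claim; it is absorbed
    because the sample size is large compared with \<open>B\<close>.\<close>
  moreover have "q * \<omega> k x \<le> e / 2"
  proof -
    have "q * \<omega> k x \<le> 1 * \<omega> k x" using q \<omega>x by (intro mult_right_mono) auto
    also have "\<dots> \<le> e / 2" using \<omega>x n by (simp add: defs)
    finally show ?thesis .
  qed
  ultimately have "q * (?S + \<omega> k x) \<le> W {z. s z \<le> t\<^sub>2}"
    using W(2) qe e unfolding distrib_left by linarith
  then have ge: "1 - \<beta> \<le> W {z. s z \<le> t\<^sub>2} / (?S + \<omega> k x)"
    using Spos \<omega>x by (simp add: pos_le_divide_eq q_def)
  have "ereal t\<^sub>1 \<le> agent_quantile s \<omega> n d \<beta> k x"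
    unfolding agent_quantile_def
  proof (rule le_Quantile)
    fix t assume t: "t < t\<^sub>1"
    have "measure (dirac_mixture {0..n k} ?c ?p) {-\<infinity><..ereal t}
        \<le> measure (dirac_mixture {0..n k} ?c ?p) {-\<infinity><..ereal t\<^sub>1}"
      using t by (intro dirac_mixture_atMost_mono) auto
    then show "measure (dirac_mixture {0..n k} ?c ?p) {-\<infinity><..ereal t} < 1 - \<beta>"
      using lt unfolding mass by linarith
  qed
  moreover have "agent_quantile s \<omega> n d \<beta> k x \<le> ereal t\<^sub>2"
    unfolding agent_quantile_def by (rule Quantile_le) (use ge in \<open>simp only: mass\<close>)
  ultimately show ?thesis by simp
qed

section \<open>The calibration model for fixed sample sizes\<close>

text \<open>One vector \<open>n\<close> of sample sizes is frozen, together with the probability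
  space and data belonging to it. The bounds proved here are non-asymptotic, and the theorem
  interprets the locale anew for each \<open>n\<close>.\<close>

locale covariate_shift_model = prob_space M
  for M :: "'w measure" +
  fixes K :: nat and \<beta> \<tau> A B :: real
    and MX :: "'x measure" and MY :: "'y measure"
    and PX :: "nat \<Rightarrow> 'x measure" and \<kappa> :: "'x \<Rightarrow> 'y measure"
    and P :: "nat \<Rightarrow> ('x \<times> 'y) measure"
    and s :: "'x \<times> 'y \<Rightarrow> real" and \<omega> :: "nat \<Rightarrow> 'x \<Rightarrow> real"
    and n :: "nat \<Rightarrow> nat"
    and Z :: "nat \<times> nat \<Rightarrow> 'w \<Rightarrow> 'x \<times> 'y"
    and D :: "'w \<Rightarrow> (nat \<times> nat \<Rightarrow> 'x \<times> 'y)"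
    and S :: "(nat \<times> nat \<Rightarrow> 'x \<times> 'y) measure"
  assumes K: "1 \<le> K" and \<beta>: "0 < \<beta>" "\<beta> < 1" and \<tau>: "0 \<le> \<tau>" "\<tau> < 1"
    and PX: "\<And>k. k \<in> {1..K} \<Longrightarrow> PX k \<in> space (prob_algebra MX)"
    and \<kappa>: "\<kappa> \<in> MX \<rightarrow>\<^sub>M prob_algebra MY"
    and P: "\<And>k. P k = joint_law MX MY (PX k) \<kappa>"
    and s [measurable]: "s \<in> borel_measurable (MX \<Otimes>\<^sub>M MY)"
    and ac: "\<And>k. k \<in> {1..K} \<Longrightarrow> absolutely_continuous (P k) (P 1)"
    and \<omega>_meas: "\<And>k. k \<in> {1..K} \<Longrightarrow> \<omega> k \<in> borel_measurable MX"
    and \<omega>: "\<And>k. k \<in> {1..K} \<Longrightarrow> AE x in PX k. \<omega> k x = enn2real (RN_deriv (PX k) (PX 1) x)"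
    and AB: "0 < A" "A \<le> 1" "1 \<le> B"
    and \<omega>_bounds: "\<And>k. k \<in> {1..K} \<Longrightarrow> measure (PX k) {x \<in> space MX. \<omega> k x \<in> {A..B}} = 1"
    and Z_indep: "indep_vars (\<lambda>_. MX \<Otimes>\<^sub>M MY) Z (data_index K n)"
    and Z_law: "\<And>k i. (k, i) \<in> data_index K n \<Longrightarrow> distr M (MX \<Otimes>\<^sub>M MY) (Z (k, i)) = P k"
    and S: "S = PiM (data_index K n) (\<lambda>_. MX \<Otimes>\<^sub>M MY)"
    and D: "D = (\<lambda>\<xi>. \<lambda>j\<in>data_index K n. Z j \<xi>)"
begin

lemma one_in [simp]: "1 \<in> {1..K}" "Suc 0 \<in> {1..K}" "Suc 0 \<le> K"
  using K by auto

lemma data_index_iff [simp]: "(k, i) \<in> data_index K n \<longleftrightarrow> k \<in> {1..K} \<and> i \<in> {1..n k}"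
  by (auto simp: data_index_def)

lemma sets_P: "k \<in> {1..K} \<Longrightarrow> sets (P k) = sets (MX \<Otimes>\<^sub>M MY)"
  by (simp add: P sets_joint_law[OF PX \<kappa>])

lemma prob_space_P: "k \<in> {1..K} \<Longrightarrow> prob_space (P k)"
  by (simp add: P prob_space_joint_law[OF PX \<kappa>])

lemma measurable_Z: "k \<in> {1..K} \<Longrightarrow> i \<in> {1..n k} \<Longrightarrow> Z (k, i) \<in> M \<rightarrow>\<^sub>M MX \<Otimes>\<^sub>M MY"
  using Z_indep by (auto simp: indep_vars_def)

lemma D_eq: "k \<in> {1..K} \<Longrightarrow> i \<in> {1..n k} \<Longrightarrow> D \<xi> (k, i) = Z (k, i) \<xi>"
  by (simp add: D)

lemma measurable_D [measurable]: "D \<in> M \<rightarrow>\<^sub>M S"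
  unfolding D S using measurable_Z by (intro measurable_restrict) auto

section \<open>Importance weights and the change of measure to the test law\<close>

lemma AE_\<omega>_bounds_marginal:
  assumes k: "k \<in> {1..K}"
  shows "AE x in PX k. \<omega> k x \<in> {A..B}"
proof -
  have sets: "sets (PX k) = sets MX" and space: "space (PX k) = space MX" and "prob_space (PX k)"
    using PX[OF k] by (auto simp: space_prob_algebra dest: sets_eq_imp_space_eq)
  then interpret PXk: prob_space "PX k" by simp
  have "{x \<in> space MX. \<omega> k x \<in> {A..B}} \<in> sets MX" using \<omega>_meas[OF k] by measurable
  then have "AE x in PX k. x \<in> {x \<in> space MX. \<omega> k x \<in> {A..B}}"
    using \<omega>_bounds[OF k] sets by (subst PXk.AE_in_set_eq_1) auto
  then show ?thesis by eventually_elim auto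
qed

lemma AE_\<omega>_bounds:
  assumes k: "k \<in> {1..K}"
  shows "AE z in P k. \<omega> k (fst z) \<in> {A..B}"
  unfolding P using PX[OF k] \<kappa> AE_\<omega>_bounds_marginal[OF k] \<omega>_meas[OF k]
  by (intro AE_joint_law_fst) auto

text \<open>The weight bounds are assumed under agent \<open>k\<close>, but the test covariate
  follows agent 1; absolute continuity carries them over.\<close>

lemma AE_\<omega>_bounds_test:
  assumes k: "k \<in> {1..K}"
  shows "AE z in P 1. \<omega> k (fst z) \<in> {A..B}"
  by (rule absolutely_continuous_AE[OF _ ac[OF k] AE_\<omega>_bounds[OF k]]) (simp add: sets_P[OF k] sets_P)

lemma P1_eq_density:
  assumes k: "k \<in> {1..K}"
  shows "P 1 = density (P k) (\<lambda>z. ennreal (\<omega> k (fst z)))"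
proof -
  note [measurable] = \<omega>_meas[OF k]
  have sets: "sets (PX k) = sets MX" and space: "space (PX k) = space MX" and prob: "prob_space (PX k)"
    using PX[OF k] by (auto simp: space_prob_algebra dest: sets_eq_imp_space_eq)
  have sets1: "sets (PX 1) = sets MX"
    using PX[of 1] by (auto simp: space_prob_algebra)
  interpret PXk: prob_space "PX k" by fact
  have "absolutely_continuous (PX k) (PX 1)"
    using ac[OF k] unfolding P by (rule absolutely_continuous_marginal[OF PX[OF k] PX \<kappa>, rotated]) simp
  then have "PX 1 = density (PX k) (RN_deriv (PX k) (PX 1))"
    using sets sets1 by (intro PXk.density_RN_deriv[symmetric]) auto
  also have "\<dots> = density (PX k) (\<lambda>x. ennreal (\<omega> k x))"
  proof (rule density_cong)
    show "(\<lambda>x. ennreal (\<omega> k x)) \<in> borel_measurable (PX k)"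
      using sets by (simp cong: measurable_cong_sets)
    show "AE x in PX k. RN_deriv (PX k) (PX 1) x = ennreal (\<omega> k x)"
      using \<omega>[OF k] AE_\<omega>_bounds_marginal[OF k]
    proof eventually_elim
      case (elim x)
      \<comment> \<open>\<open>enn2real\<close> sends \<open>\<top>\<close> to 0, which the lower
        bound \<open>A > 0\<close> on the weight excludes. Hence no information is lost in the
        real-valued \<open>\<omega>\<close>.\<close>
      then have "RN_deriv (PX k) (PX 1) x < \<top>"
        using AB by (auto simp: less_top[symmetric])
      then show ?case using elim by simp
    qed
  qed simp
  finally have eq: "PX 1 = density (PX k) (\<lambda>x. ennreal (\<omega> k x))" .
  show ?thesis
    unfolding P by (rule joint_law_density[OF PX[OF k] PX \<kappa> _ eq]) auto
qed

text \<open>The importance-sampling identity: \<open>\<omega> k\<close> is the density of the test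
  law relative to agent \<open>k\<close>. For the whole space it says that the weights have mean
  1.\<close>

lemma integral_weight:
  assumes k: "k \<in> {1..K}" and C: "C \<in> sets (MX \<Otimes>\<^sub>M MY)"
  shows "(\<integral>z. \<omega> k (fst z) * indicator C z \<partial>P k) = measure (P 1) C"
proof -
  note [measurable] = \<omega>_meas[OF k] C and [measurable_cong] = sets_P[OF k]
  have "measure (P 1) C = (\<integral>z. indicator C z \<partial>P 1)"
    using C sets_P[of 1] sets.sets_into_space[OF C] by (simp add: sets_eq_imp_space_eq[OF sets_P] Int_absorb2)
  also have "\<dots> = (\<integral>z. \<omega> k (fst z) * indicator C z \<partial>P k)"
    unfolding P1_eq_density[OF k]
  proof (subst integral_density)
    show "AE z in P k. 0 \<le> \<omega> k (fst z)"
      using AE_\<omega>_bounds[OF k] by eventually_elim (use AB in auto)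
  qed auto
  finally show ?thesis by simp
qed

lemma weight_mass_Z:
  "k \<in> {1..K} \<Longrightarrow> weight_mass \<omega> n (D \<xi>) k C =
     (\<Sum>i=1..n k. \<omega> k (fst (Z (k, i) \<xi>)) * indicator C (Z (k, i) \<xi>))"
  by (simp add: weight_mass_def D_eq)

lemma weight_mass_concentration:
  fixes \<eta> :: real
  assumes k: "k \<in> {1..K}" "0 < n k" and C: "C \<in> sets (MX \<Otimes>\<^sub>M MY)" and \<eta>: "0 \<le> \<eta>"
  shows "prob {\<xi> \<in> space M. \<bar>weight_mass \<omega> n (D \<xi>) k C - n k * measure (P 1) C\<bar> \<ge> \<eta> * n k}
    \<le> 2 * exp (- 2 * n k * \<eta>\<^sup>2 / B\<^sup>2)"
proof -
  let ?h = "\<lambda>z. \<omega> k (fst z) * indicator C z"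
  \<comment> \<open>Independence is given for the family indexed by pairs, so the sum for agent
    \<open>k\<close> is taken over the row of pairs with first entry \<open>k\<close> and reindexed
    at the end.\<close>
  let ?I = "Pair k ` {1..n k}"
  note [measurable] = \<omega>_meas[OF k(1)] C
  have inj: "inj_on (Pair k) A" for A :: "nat set" by (auto intro: inj_onI)
  have "prob {\<xi> \<in> space M. \<bar>(\<Sum>i\<in>?I. ?h (Z i \<xi>)) - card ?I * integral\<^sup>L (P k) ?h\<bar> \<ge> \<eta> * card ?I}
    \<le> 2 * exp (- 2 * card ?I * \<eta>\<^sup>2 / B\<^sup>2)"
  proof (rule iid_mean_concentration[where T = "MX \<Otimes>\<^sub>M MY"])
    show "indep_vars (\<lambda>_. MX \<Otimes>\<^sub>M MY) Z ?I"
      using Z_indep by (rule indep_vars_subset) (use k in auto)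
    show "AE z in P k. ?h z \<in> {0..B}"
      using AE_\<omega>_bounds[OF k(1)] by eventually_elim (use AB in \<open>auto simp: indicator_def\<close>)
  qed (use k Z_law \<eta> AB in auto)
  then show ?thesis
    by (simp add: weight_mass_Z[OF k(1)] sum.reindex[OF inj] card_image[OF inj] integral_weight[OF k(1) C])
qed

lemma AE_D_weights:
  "AE \<xi> in M. \<forall>k\<in>{1..K}. \<forall>i\<in>{1..n k}. \<omega> k (fst (D \<xi> (k, i))) \<in> {A..B}"
proof -
  have "AE \<xi> in M. \<omega> k (fst (Z (k, i) \<xi>)) \<in> {A..B}" if "k \<in> {1..K}" "i \<in> {1..n k}" for k i
  proof -
    note [measurable] = measurable_Z[OF that] \<omega>_meas[OF that(1)]
    have "AE z in distr M (MX \<Otimes>\<^sub>M MY) (Z (k, i)). \<omega> k (fst z) \<in> {A..B}"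
      using that AE_\<omega>_bounds[OF that(1)] by (subst Z_law) auto
    then show ?thesis by (subst (asm) AE_distr_iff) auto
  qed
  then have "AE \<xi> in M. \<forall>k\<in>{1..K}. \<forall>i\<in>{1..n k}. \<omega> k (fst (Z (k, i) \<xi>)) \<in> {A..B}"
    by (intro AE_ball_countable[THEN iffD2] ballI) auto
  then show ?thesis by eventually_elim (simp add: D_eq)
qed

section \<open>Effective sample sizes and aggregation weights\<close>

lemma borel_measurable_weight_D:
  assumes "k \<in> {1..K}" "i \<in> {1..n k}"
  shows "(\<lambda>\<xi>. \<omega> k (fst (D \<xi> (k, i)))) \<in> borel_measurable M"
  using measurable_Z[OF assms] \<omega>_meas[OF assms(1)] by (simp add: D_eq[OF assms])

lemma borel_measurable_n_eff:
  assumes "k \<in> {1..K}"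
  shows "(\<lambda>\<xi>. n_eff \<omega> n (D \<xi>) k) \<in> borel_measurable M"
  unfolding n_eff_def L2_set_def using borel_measurable_weight_D[OF assms] by measurable

lemma borel_measurable_aggregation_weights:
  assumes "aggregation_weights K \<omega> w" "k \<in> {1..K}"
  shows "(\<lambda>\<xi>. w n (D \<xi>) k) \<in> borel_measurable M"
  using assms(1) unfolding aggregation_weights_def
proof (elim disjE exE conjE)
  assume "\<forall>n d. \<forall>k\<in>{1..K}. w n d k = n_eff \<omega> n d k / (\<Sum>l=1..K. n_eff \<omega> n d l)"
  then show ?thesis using assms(2) borel_measurable_n_eff by simp
qed (use assms(2) in auto)

text \<open>The squared sum of weights is at least \<open>(n k * A)\<^sup>2\<close> and the sum of
  squares at most \<open>n k * B\<^sup>2\<close>. So the effective sample size grows at least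
  linearly, with a constant free of the data.\<close>

lemma n_eff_ge:
  assumes k: "k \<in> {1..K}" "0 < n k" and bounds: "\<And>i. i \<in> {1..n k} \<Longrightarrow> \<omega> k (fst (d (k, i))) \<in> {A..B}"
  shows "n k * (A / B)\<^sup>2 \<le> n_eff \<omega> n d k"
proof -
  let ?w = "\<lambda>i. \<omega> k (fst (d (k, i)))"
  have "n k * A \<le> (\<Sum>i=1..n k. \<bar>?w i\<bar>)"
    using bounds sum_bounded_below[of "{1..n k}" A "\<lambda>i. \<bar>?w i\<bar>"] by (force simp: mult.commute)
  then have l1: "(n k * A)\<^sup>2 \<le> (\<Sum>i=1..n k. \<bar>?w i\<bar>)\<^sup>2"
    using AB by (intro power_mono) auto
  have le: "A\<^sup>2 \<le> (?w i)\<^sup>2" "(?w i)\<^sup>2 \<le> B\<^sup>2" if "i \<in> {1..n k}" for i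
    using bounds[OF that] AB by (auto intro!: power_mono)
  have "(L2_set ?w {1..n k})\<^sup>2 = (\<Sum>i=1..n k. (?w i)\<^sup>2)"
    by (simp add: L2_set_def sum_nonneg)
  moreover have "\<dots> \<le> n k * B\<^sup>2"
    using le sum_bounded_above[of "{1..n k}" "\<lambda>i. (?w i)\<^sup>2" "B\<^sup>2"] by simp
  \<comment> \<open>This lower bound keeps the denominator of \<open>n_eff\<close> away from
    0.\<close>
  moreover have "n k * A\<^sup>2 \<le> (\<Sum>i=1..n k. (?w i)\<^sup>2)"
    using le sum_bounded_below[of "{1..n k}" "A\<^sup>2" "\<lambda>i. (?w i)\<^sup>2"] by simp
  moreover have "0 < n k * A\<^sup>2" using k AB by simp
  ultimately have l2: "0 < (L2_set ?w {1..n k})\<^sup>2" "(L2_set ?w {1..n k})\<^sup>2 \<le> n k * B\<^sup>2" by linarith+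
  have "n k * (A / B)\<^sup>2 = (n k * A)\<^sup>2 / (n k * B\<^sup>2)"
    using k AB by (simp add: field_simps power2_eq_square)
  also have "\<dots> \<le> n_eff \<omega> n d k"
    unfolding n_eff_def using l1 l2 by (intro frac_le) auto
  finally show ?thesis .
qed

text \<open>For weights proportional to \<open>n_eff\<close> the normalising sum must be positive,
  since division by 0 would yield weights summing to 0; positive sample sizes and the bounds on the
  importance weights ensure this.\<close>

lemma aggregation_weights_convex:
  assumes w: "aggregation_weights K \<omega> w" and n: "\<And>k. k \<in> {1..K} \<Longrightarrow> 0 < n k"
    and bounds: "\<And>k i. k \<in> {1..K} \<Longrightarrow> i \<in> {1..n k} \<Longrightarrow> \<omega> k (fst (d (k, i))) \<in> {A..B}"
  shows "\<And>k. k \<in> {1..K} \<Longrightarrow> 0 \<le> w n d k" "(\<Sum>k=1..K. w n d k) = 1"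
proof -
  have "(\<forall>k\<in>{1..K}. 0 \<le> w n d k) \<and> (\<Sum>k=1..K. w n d k) = 1"
    using w unfolding aggregation_weights_def
  proof (elim disjE exE conjE)
    assume eq: "\<forall>n d. \<forall>k\<in>{1..K}. w n d k = n_eff \<omega> n d k / (\<Sum>l=1..K. n_eff \<omega> n d l)"
    have pos: "0 < n_eff \<omega> n d k" if k: "k \<in> {1..K}" for k
    proof -
      have "0 < n k * (A / B)\<^sup>2" using n[OF k] AB by simp
      also have "\<dots> \<le> n_eff \<omega> n d k" using k n bounds by (intro n_eff_ge)
      finally show ?thesis .
    qed
    then have "0 < (\<Sum>l=1..K. n_eff \<omega> n d l)" using K by (intro sum_pos) auto
    then show ?thesis
      using eq pos by (auto simp: sum_divide_distrib[symmetric] less_imp_le intro!: divide_nonneg_nonneg sum_nonneg)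
  qed auto
  then show "\<And>k. k \<in> {1..K} \<Longrightarrow> 0 \<le> w n d k" "(\<Sum>k=1..K. w n d k) = 1" by auto
qed

end

section \<open>Concentration of the two sides\<close>

text \<open>Continuity of the score distribution enters here: the limits 0 and 1 of the cdf bracket
  \<open>p\<close>, and the intermediate value theorem gives a threshold with exactly this
  level.\<close>

lemma cdf_intermediate_value:
  assumes "real_distribution \<mu>" and cont: "continuous_on UNIV (cdf \<mu>)" and p: "0 < p" "p < 1"
  obtains t where "cdf \<mu> t = p"
proof -
  interpret real_distribution \<mu> by fact
  have "eventually (\<lambda>x. cdf \<mu> x < p) at_bot" "eventually (\<lambda>x. p < cdf \<mu> x) at_top"
    using order_tendstoD(2)[OF cdf_lim_at_bot p(1)] order_tendstoD(1)[OF cdf_lim_at_top_prob p(2)] by auto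
  then obtain a b where ab: "\<And>x. x \<le> a \<Longrightarrow> cdf \<mu> x < p" "\<And>x. b \<le> x \<Longrightarrow> p < cdf \<mu> x"
    unfolding eventually_at_bot_linorder eventually_at_top_linorder by blast
  have "a \<le> b" using ab(1)[of a] ab(2)[of a] by force
  then have "\<exists>x\<ge>a. x \<le> b \<and> cdf \<mu> x = p"
    using ab(1)[of a] ab(2)[of b] by (intro IVT' continuous_on_subset[OF cont]) auto
  then show thesis using that by blast
qed

context covariate_shift_model
begin

lemma measurable_weight_mass:
  assumes k: "k \<in> {1..K}" and C [measurable]: "C \<in> sets (MX \<Otimes>\<^sub>M MY)"
  shows "(\<lambda>d. weight_mass \<omega> n d k C) \<in> borel_measurable S"
proof -
  have "(\<lambda>d. \<omega> k (fst (d (k, i))) * indicator C (d (k, i))) \<in> borel_measurable S" if "i \<in> {1..n k}" for i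
  proof -
    have [measurable]: "(\<lambda>d. d (k, i)) \<in> S \<rightarrow>\<^sub>M MX \<Otimes>\<^sub>M MY"
      unfolding S using k that by (intro measurable_component_singleton) auto
    note [measurable] = \<omega>_meas[OF k]
    show ?thesis by measurable
  qed
  then show ?thesis unfolding weight_mass_def by (rule borel_measurable_sum)
qed

text \<open>Sublevel sets of \<open>s\<close> in the whole type need not be measurable, while those
  inside the space are. On the data both have the same mass, as the sample points lie in the
  space.\<close>

lemma weight_mass_D_Int_space:
  assumes "k \<in> {1..K}" "\<xi> \<in> space M"
  shows "weight_mass \<omega> n (D \<xi>) k (C \<inter> space (MX \<Otimes>\<^sub>M MY)) = weight_mass \<omega> n (D \<xi>) k C"
  unfolding weight_mass_Z[OF assms(1)]
  using measurable_space[OF measurable_Z[OF assms(1)] assms(2)]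
  by (intro sum.cong) (auto simp: indicator_def)

lemma borel_measurable_agent_quantile:
  assumes k: "k \<in> {1..K}" and X: "X \<in> M \<rightarrow>\<^sub>M MX"
  shows "(\<lambda>\<xi>. agent_quantile s \<omega> n (D \<xi>) \<beta> k (X \<xi>)) \<in> borel_measurable M"
  unfolding agent_quantile_def
proof (rule borel_measurable_Quantile_dirac_mixture)
  fix i assume i: "i \<in> {0..n k}"
  note [measurable] = \<omega>_meas[OF k] X
  have [measurable]: "(\<lambda>\<xi>. \<Sum>j = 1..n k. \<omega> k (fst (D \<xi> (k, j)))) \<in> borel_measurable M"
    using borel_measurable_weight_D[OF k] by (rule borel_measurable_sum)
  have [measurable]: "(\<lambda>\<xi>. \<omega> k (fst (D \<xi> (k, i)))) \<in> borel_measurable M" if "i \<noteq> 0"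
    using i that by (intro borel_measurable_weight_D k) auto
  show "(\<lambda>\<xi>. (if i = 0 then \<omega> k (X \<xi>) else \<omega> k (fst (D \<xi> (k, i)))) /
      ((\<Sum>j = 1..n k. \<omega> k (fst (D \<xi> (k, j)))) + \<omega> k (X \<xi>))) \<in> borel_measurable M"
  proof (cases "i = 0")
    case True
    have "(\<lambda>\<xi>. \<omega> k (X \<xi>) / ((\<Sum>j = 1..n k. \<omega> k (fst (D \<xi> (k, j)))) + \<omega> k (X \<xi>))) \<in> borel_measurable M"
      by measurable
    then show ?thesis using True by simp
  next
    case False
    then have "(\<lambda>\<xi>. \<omega> k (fst (D \<xi> (k, i))) / ((\<Sum>j = 1..n k. \<omega> k (fst (D \<xi> (k, j)))) + \<omega> k (X \<xi>))) \<in> borel_measurable M"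
      by measurable
    then show ?thesis using False by simp
  qed
  show "(\<lambda>\<xi>. if i = 0 then \<infinity> else ereal (s (D \<xi> (k, i)))) \<in> borel_measurable M"
    using i k measurable_Z[OF k, of i] by (cases "i = 0") (simp_all add: D_eq[OF k])
qed simp

text \<open>All sampled covariates and the test covariate lie in \<open>space MX\<close>, where
  \<open>\<omega>_hat\<close> equals \<open>\<omega>\<close>, and the test label lies in
  \<open>space MY\<close>. Coverage becomes a comparison of a score with a threshold.\<close>

lemma coverage_event_eq:
  assumes \<omega>_hat: "\<And>k x. k \<in> {1..K} \<Longrightarrow> x \<in> space MX \<Longrightarrow> \<omega>_hat k x = \<omega> k x"
    and XY [measurable]: "XY \<in> M \<rightarrow>\<^sub>M MX \<Otimes>\<^sub>M MY"
  shows "{\<xi> \<in> space M. snd (XY \<xi>) \<in> wqq_prediction_set MY s \<omega>_hat K n (w n (D \<xi>)) (D \<xi>) \<beta> \<tau> (fst (XY \<xi>))} =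
    {\<xi> \<in> space M. ereal (s (XY \<xi>)) \<le> wqq_threshold s \<omega> K n (w n (D \<xi>)) (D \<xi>) \<beta> \<tau> (fst (XY \<xi>))}"
proof -
  have "wqq_threshold s \<omega>_hat K n (w n (D \<xi>)) (D \<xi>) \<beta> \<tau> (fst (XY \<xi>)) =
      wqq_threshold s \<omega> K n (w n (D \<xi>)) (D \<xi>) \<beta> \<tau> (fst (XY \<xi>))" if \<xi>: "\<xi> \<in> space M" for \<xi>
  proof -
    have X: "fst (XY \<xi>) \<in> space MX"
      using measurable_space[OF XY \<xi>] by (auto simp: space_pair_measure)
    have Z: "fst (D \<xi> (k, i)) \<in> space MX" if "k \<in> {1..K}" "i \<in> {1..n k}" for k i
      using measurable_space[OF measurable_Z[OF that] \<xi>] by (auto simp: space_pair_measure D_eq[OF that])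
    have "agent_quantile s \<omega>_hat n (D \<xi>) \<beta> k (fst (XY \<xi>)) = agent_quantile s \<omega> n (D \<xi>) \<beta> k (fst (XY \<xi>))"
      if k: "k \<in> {1..K}" for k
    proof -
      have "(\<Sum>j = 1..n k. \<omega>_hat k (fst (D \<xi> (k, j)))) = (\<Sum>j = 1..n k. \<omega> k (fst (D \<xi> (k, j))))"
        using Z \<omega>_hat k by (intro sum.cong) auto
      then show ?thesis
        unfolding agent_quantile_def
        by (intro Quantile_dirac_mixture_cong) (use X Z k \<omega>_hat in auto)
    qed
    then show ?thesis
      unfolding wqq_threshold_def by (intro Quantile_dirac_mixture_cong) auto
  qed
  then show ?thesis
    using measurable_space[OF XY] by (auto simp: wqq_prediction_set_def space_pair_measure mem_Times_iff)
qed

lemma borel_measurable_wqq_threshold: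
  assumes w: "aggregation_weights K \<omega> w" and X: "X \<in> M \<rightarrow>\<^sub>M MX"
  shows "(\<lambda>\<xi>. wqq_threshold s \<omega> K n (w n (D \<xi>)) (D \<xi>) \<beta> \<tau> (X \<xi>)) \<in> borel_measurable M"
  unfolding wqq_threshold_def
  by (intro borel_measurable_Quantile_dirac_mixture borel_measurable_aggregation_weights[OF w]
      borel_measurable_agent_quantile X) auto

text \<open>A union bound over agents and over three sets per agent: the whole space, for the
  normalisation, and two sublevel sets of the score. Off these deviations the conditional coverage
  is within \<open>\<epsilon>\<close> of \<open>1 - \<beta>\<close>.\<close>

lemma coverage_concentration:
  assumes \<omega>_hat: "\<And>k x. k \<in> {1..K} \<Longrightarrow> x \<in> space MX \<Longrightarrow> \<omega>_hat k x = \<omega> k x"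
    and w: "aggregation_weights K \<omega> w"
    and s_cont: "continuous_on UNIV (cdf (distr (P 1) borel s))"
    and XY_indep: "independent_rvs M S D (MX \<Otimes>\<^sub>M MY) XY"
    and XY_law: "distr M (MX \<Otimes>\<^sub>M MY) XY = P 1"
    and \<epsilon>: "0 < \<epsilon>" "\<epsilon> < \<beta>" "\<epsilon> < 1 - \<beta>"
    and n: "\<And>k. k \<in> {1..K} \<Longrightarrow> B \<le> \<epsilon> / 2 * n k"
  shows "prob {\<xi> \<in> space M. \<epsilon> < \<bar>prob_given M S D
      {\<xi> \<in> space M. snd (XY \<xi>) \<in>
         wqq_prediction_set MY s \<omega>_hat K n (w n (D \<xi>)) (D \<xi>) \<beta> \<tau> (fst (XY \<xi>))} \<xi> - (1 - \<beta>)\<bar>}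
    \<le> (\<Sum>k=1..K. 6 * exp (- 2 * n k * (\<epsilon> / 4)\<^sup>2 / B\<^sup>2))"
proof -
  have XY [measurable]: "XY \<in> M \<rightarrow>\<^sub>M MX \<Otimes>\<^sub>M MY"
    using XY_indep by (simp add: independent_rvs_def)
  let ?Q = "\<lambda>\<xi>. wqq_threshold s \<omega> K n (w n (D \<xi>)) (D \<xi>) \<beta> \<tau> (fst (XY \<xi>))"
  define E where "E = {\<xi> \<in> space M. ereal (s (XY \<xi>)) \<le> ?Q \<xi>}"
  have [measurable]: "?Q \<in> borel_measurable M"
    using w by (rule borel_measurable_wqq_threshold) measurable
  have event_eq: "{\<xi> \<in> space M. snd (XY \<xi>) \<in>
      wqq_prediction_set MY s \<omega>_hat K n (w n (D \<xi>)) (D \<xi>) \<beta> \<tau> (fst (XY \<xi>))} = E"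
    unfolding E_def by (rule coverage_event_eq[OF _ XY]) (rule \<omega>_hat)
  have E: "E \<in> events" unfolding E_def by measurable
  have n_pos: "0 < n k" if "k \<in> {1..K}" for k
    using n[OF that] AB by (intro gr0I) auto

  interpret P1: prob_space "P 1" by (rule prob_space_P) simp
  have space_P1: "space (P 1) = space (MX \<Otimes>\<^sub>M MY)" by (rule sets_eq_imp_space_eq) (simp add: sets_P)
  have s_P1: "s \<in> borel_measurable (P 1)" using s by (simp add: measurable_cong_sets[OF sets_P])
  interpret F: real_distribution "distr (P 1) borel s"
    using s_P1 by (intro real_distribution.intro P1.prob_space_distr) (auto simp: real_distribution_axioms_def)
  have F: "cdf (distr (P 1) borel s) t = measure (P 1) {z \<in> space (MX \<Otimes>\<^sub>M MY). s z \<le> t}" for t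
    using s_P1 by (simp add: cdf_def measure_distr space_P1 vimage_def Int_def conj_commute del: One_nat_def)
  \<comment> \<open>The two conditions on \<open>\<epsilon>\<close> besides positivity keep the
    levels \<open>1 - \<beta> - \<epsilon>\<close> and \<open>1 - \<beta> + \<epsilon>\<close>
    strictly between 0 and 1.\<close>
  obtain t\<^sub>1 where t1: "measure (P 1) {z \<in> space (MX \<Otimes>\<^sub>M MY). s z \<le> t\<^sub>1} = 1 - \<beta> - \<epsilon>"
    using \<epsilon> \<beta> cdf_intermediate_value[OF F.real_distribution_axioms s_cont, of "1 - \<beta> - \<epsilon>"] unfolding F by auto
  obtain t\<^sub>2 where t2: "measure (P 1) {z \<in> space (MX \<Otimes>\<^sub>M MY). s z \<le> t\<^sub>2} = 1 - \<beta> + \<epsilon>"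
    using \<epsilon> \<beta> cdf_intermediate_value[OF F.real_distribution_axioms s_cont, of "1 - \<beta> + \<epsilon>"] unfolding F by auto

  define C where "C = (\<lambda>j::nat. {z \<in> space (MX \<Otimes>\<^sub>M MY). if j = 0 then True else if j = 1 then s z \<le> t\<^sub>1 else s z \<le> t\<^sub>2})"
  have C [measurable]: "C j \<in> sets (MX \<Otimes>\<^sub>M MY)" for j
    unfolding C_def by (cases "j = 0"; cases "j = 1") simp_all
  have C_prob: "measure (P 1) (C 0) = 1" "measure (P 1) (C 1) = 1 - \<beta> - \<epsilon>" "measure (P 1) (C 2) = 1 - \<beta> + \<epsilon>"
    using t1 t2 P1.prob_space by (simp_all add: C_def space_P1 del: One_nat_def)
  \<comment> \<open>\<open>G\<close> is a set of data values, not of outcomes, so that its indicator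
    is a function of \<open>D\<close>. The strict inequality makes its complement the union of the
    deviation events in Hoeffding's bound.\<close>
  define G where "G = {d \<in> space S. \<forall>k\<in>{1..K}. \<forall>j\<in>{..<3}.
      \<bar>weight_mass \<omega> n d k (C j) - n k * measure (P 1) (C j)\<bar> < \<epsilon> / 4 * n k}"
  have G: "G \<in> sets S"
  proof -
    have [measurable]: "(\<lambda>d. weight_mass \<omega> n d k (C j)) \<in> borel_measurable S" if "k \<in> {1..K}" for k j
      using that C by (rule measurable_weight_mass)
    show ?thesis unfolding G_def by measurable
  qed

  \<comment> \<open>The threshold varies with the test covariate, but its bracket does not: the
    covariate enters only through a weight that almost surely lies in \<open>{A..B}\<close>.\<close>
  have threshold: "AE \<xi> in M. D \<xi> \<in> G \<longrightarrow> ?Q \<xi> \<in> {ereal t\<^sub>1..ereal t\<^sub>2}"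
  proof -
    have "AE \<xi> in M. \<forall>k\<in>{1..K}. \<omega> k (fst (XY \<xi>)) \<in> {A..B}"
    proof (intro AE_ball_countable[THEN iffD2] ballI)
      fix k assume k: "k \<in> {1..K}"
      note [measurable] = \<omega>_meas[OF k]
      have "AE z in distr M (MX \<Otimes>\<^sub>M MY) XY. \<omega> k (fst z) \<in> {A..B}"
        unfolding XY_law using k by (rule AE_\<omega>_bounds_test)
      then show "AE \<xi> in M. \<omega> k (fst (XY \<xi>)) \<in> {A..B}" by (subst (asm) AE_distr_iff) auto
    qed auto
    with AE_D_weights AE_space show ?thesis
    proof eventually_elim
      case (elim \<xi>)
      show ?case
      proof
        assume DG: "D \<xi> \<in> G"
        have mass: "\<bar>weight_mass \<omega> n (D \<xi>) k H - n k * measure (P 1) (C j)\<bar> \<le> \<epsilon> / 4 * n k"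
          if "k \<in> {1..K}" "j \<in> {..<3}" "C j = H \<inter> space (MX \<Otimes>\<^sub>M MY)" for k j H
        proof -
          have "\<bar>weight_mass \<omega> n (D \<xi>) k (C j) - n k * measure (P 1) (C j)\<bar> < \<epsilon> / 4 * n k"
            using DG that(1,2) unfolding G_def by blast
          then show ?thesis
            unfolding weight_mass_D_Int_space[OF that(1) elim(2), of H, folded that(3)] by (rule less_imp_le)
        qed
        have "agent_quantile s \<omega> n (D \<xi>) \<beta> k (fst (XY \<xi>)) \<in> {ereal t\<^sub>1..ereal t\<^sub>2}"
          if k: "k \<in> {1..K}" for k
        proof (rule agent_quantile_between)
          show "\<bar>weight_mass \<omega> n (D \<xi>) k UNIV - n k\<bar> \<le> \<epsilon> / 4 * n k"
            using mass[OF k, of 0 UNIV] unfolding C_prob by (auto simp: C_def)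
          show "\<bar>weight_mass \<omega> n (D \<xi>) k {z. s z \<le> t\<^sub>1} - n k * (1 - \<beta> - \<epsilon>)\<bar> \<le> \<epsilon> / 4 * n k"
            using mass[OF k, of 1 "{z. s z \<le> t\<^sub>1}"] unfolding C_prob by (auto simp: C_def)
          show "\<bar>weight_mass \<omega> n (D \<xi>) k {z. s z \<le> t\<^sub>2} - n k * (1 - \<beta> + \<epsilon>)\<bar> \<le> \<epsilon> / 4 * n k"
            using mass[OF k, of 2 "{z. s z \<le> t\<^sub>2}"] unfolding C_prob by (auto simp: C_def)
        qed (use k elim n[OF k] AB \<beta> \<epsilon> in auto)
        then show "?Q \<xi> \<in> {ereal t\<^sub>1..ereal t\<^sub>2}"
          unfolding wqq_threshold_def
          using \<tau> elim n_pos aggregation_weights_convex[OF w n_pos, of "D \<xi>"]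
          by (intro Quantile_dirac_mixture_between) auto
      qed
    qed
  qed
  have "AE \<xi> in M. D \<xi> \<in> G \<longrightarrow>
    prob_given M S D E \<xi> \<in> {prob {\<xi> \<in> space M. XY \<xi> \<in> C 1}..prob {\<xi> \<in> space M. XY \<xi> \<in> C 2}}"
  proof (rule prob_given_between[OF XY_indep G C C E])
    show "AE \<xi> in M. D \<xi> \<in> G \<longrightarrow> XY \<xi> \<in> C 1 \<longrightarrow> \<xi> \<in> E"
      using threshold AE_space
    proof eventually_elim
      case (elim \<xi>)
      then show ?case
        by (auto simp: E_def C_def intro: order_trans[of _ "ereal t\<^sub>1"])
    qed
    show "AE \<xi> in M. D \<xi> \<in> G \<longrightarrow> \<xi> \<in> E \<longrightarrow> XY \<xi> \<in> C 2"
      using threshold AE_space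
    proof eventually_elim
      case (elim \<xi>)
      show ?case
      proof (intro impI)
        assume "D \<xi> \<in> G" "\<xi> \<in> E"
        then have "ereal (s (XY \<xi>)) \<le> ?Q \<xi>" "?Q \<xi> \<le> ereal t\<^sub>2" using elim by (auto simp: E_def)
        then have "ereal (s (XY \<xi>)) \<le> ereal t\<^sub>2" by (rule order_trans)
        then show "XY \<xi> \<in> C 2" using measurable_space[OF XY] elim by (simp add: C_def)
      qed
    qed
  qed
  moreover have "prob {\<xi> \<in> space M. XY \<xi> \<in> C j} = measure (P 1) (C j)" for j
    unfolding XY_law[symmetric] by (subst measure_distr) (auto intro!: arg_cong[of _ _ prob])
  ultimately have cov: "AE \<xi> in M. D \<xi> \<in> G \<longrightarrow> prob_given M S D E \<xi> \<in> {1 - \<beta> - \<epsilon>..1 - \<beta> + \<epsilon>}"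
    by (simp only: C_prob)

  let ?bad = "\<lambda>(k, j). {\<xi> \<in> space M. \<bar>weight_mass \<omega> n (D \<xi>) k (C j) - n k * measure (P 1) (C j)\<bar> \<ge> \<epsilon> / 4 * n k}"
  have bad: "?bad kj \<in> events" if kj_in: "kj \<in> {1..K} \<times> {..<3}" for kj
  proof -
    obtain k j where kj: "kj = (k, j)" "k \<in> {1..K}" using kj_in by auto
    have [measurable]: "(\<lambda>\<xi>. weight_mass \<omega> n (D \<xi>) k (C j)) \<in> borel_measurable M"
      using measurable_weight_mass[OF kj(2) C] by (rule measurable_compose[OF measurable_D])
    show ?thesis unfolding kj(1) by simp
  qed
  have "prob {\<xi> \<in> space M. \<epsilon> < \<bar>prob_given M S D E \<xi> - (1 - \<beta>)\<bar>} \<le> prob (\<Union>kj\<in>{1..K} \<times> {..<3}. ?bad kj)"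
  proof (rule finite_measure_mono_AE)
    show "AE \<xi> in M. \<xi> \<in> {\<xi> \<in> space M. \<epsilon> < \<bar>prob_given M S D E \<xi> - (1 - \<beta>)\<bar>} \<longrightarrow>
        \<xi> \<in> (\<Union>kj\<in>{1..K} \<times> {..<3}. ?bad kj)"
      using cov AE_space
    proof eventually_elim
      case (elim \<xi>)
      show ?case
      proof
        assume "\<xi> \<in> {\<xi> \<in> space M. \<epsilon> < \<bar>prob_given M S D E \<xi> - (1 - \<beta>)\<bar>}"
        then have "D \<xi> \<notin> G" using elim by (auto simp: abs_if split: if_splits)
        then show "\<xi> \<in> (\<Union>kj\<in>{1..K} \<times> {..<3}. ?bad kj)"
          using measurable_space[OF measurable_D] elim(2) by (auto simp: G_def not_less)
      qed
    qed
    show "(\<Union>kj\<in>{1..K} \<times> {..<3}. ?bad kj) \<in> events" using bad by (intro sets.finite_UN) auto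
  qed
  also have "\<dots> \<le> (\<Sum>kj\<in>{1..K} \<times> {..<3}. prob (?bad kj))"
    using bad by (intro finite_measure_subadditive_finite) auto
  also have "\<dots> \<le> (\<Sum>kj\<in>{1..K} \<times> {..<3::nat}. 2 * exp (- 2 * n (fst kj) * (\<epsilon> / 4)\<^sup>2 / B\<^sup>2))"
  proof (rule sum_mono)
    fix kj assume "kj \<in> {1..K} \<times> {..<3::nat}"
    then obtain k j where kj: "kj = (k, j)" "k \<in> {1..K}" by auto
    show "prob (?bad kj) \<le> 2 * exp (- 2 * n (fst kj) * (\<epsilon> / 4)\<^sup>2 / B\<^sup>2)"
      using weight_mass_concentration[OF kj(2) n_pos[OF kj(2)] C, of "\<epsilon> / 4" j] \<epsilon> by (simp add: kj(1))
  qed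
  also have "\<dots> = (\<Sum>k=1..K. \<Sum>j<3::nat. 2 * exp (- 2 * n k * (\<epsilon> / 4)\<^sup>2 / B\<^sup>2))"
    unfolding sum.cartesian_product by (simp add: case_prod_beta')
  \<comment> \<open>Three sets per agent, each with the factor 2 of the two-sided bound.\<close>
  also have "\<dots> = (\<Sum>k=1..K. 6 * exp (- 2 * n k * (\<epsilon> / 4)\<^sup>2 / B\<^sup>2))"
    by simp
  finally show ?thesis
    unfolding event_eq .
qed

section \<open>The weighted quantile of the Beta variables\<close>

lemma borel_measurable_Quantile_U:
  assumes w: "aggregation_weights K \<omega> w"
    and U: "\<And>k. k \<in> {1..K} \<Longrightarrow> U k \<in> borel_measurable M"
  shows "(\<lambda>\<xi>. real_of_ereal (Quantile (1 - \<tau>) (dirac_mixture {1..K} (w n (D \<xi>)) (\<lambda>k. ereal (U k \<xi>)))))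
    \<in> borel_measurable M"
  using U by (intro borel_measurable_real_of_ereal borel_measurable_Quantile_dirac_mixture
      borel_measurable_aggregation_weights[OF w]) auto

text \<open>If every \<open>U k\<close> is within \<open>\<delta>\<close> of
  \<open>1 - \<beta>\<close>, so is their weighted quantile; a union bound over agents handles the
  rest. Given the data, \<open>U k\<close> has mean \<open>1 - \<beta>\<close> and a deviation bound
  of order \<open>1 / n_eff\<close>, made deterministic by \<open>n_eff_ge\<close>.\<close>

lemma quantile_concentration:
  assumes w: "aggregation_weights K \<omega> w"
    and U: "\<And>k. k \<in> {1..K} \<Longrightarrow> U k \<in> borel_measurable M"
    and U_law: "\<And>C. (\<And>k. k \<in> {1..K} \<Longrightarrow> C k \<in> sets borel) \<Longrightarrow>
      AE \<xi> in M. prob_given M S D {\<xi> \<in> space M. \<forall>k\<in>{1..K}. U k \<xi> \<in> C k} \<xi> =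
        (\<Prod>k=1..K. measure (beta_law ((1 - \<beta>) * (n_eff \<omega> n (D \<xi>) k + 1))
                                     (\<beta> * (n_eff \<omega> n (D \<xi>) k + 1))) (C k))"
    and n: "\<And>k. k \<in> {1..K} \<Longrightarrow> 0 < n k" and \<delta>: "0 < \<delta>"
  shows "prob {\<xi> \<in> space M. \<delta> < \<bar>real_of_ereal (Quantile (1 - \<tau>)
      (dirac_mixture {1..K} (w n (D \<xi>)) (\<lambda>k. ereal (U k \<xi>)))) - (1 - \<beta>)\<bar>}
    \<le> (\<Sum>k=1..K. 1 / (4 * (n k * (A / B)\<^sup>2) * \<delta>\<^sup>2))"
proof -
  let ?R = "\<lambda>\<xi>. real_of_ereal (Quantile (1 - \<tau>) (dirac_mixture {1..K} (w n (D \<xi>)) (\<lambda>k. ereal (U k \<xi>))))"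
  let ?H = "{x::real. \<delta> < \<bar>x - (1 - \<beta>)\<bar>}"
  let ?bad = "\<lambda>k. {\<xi> \<in> space M. U k \<xi> \<in> ?H}"
  have H [measurable]: "?H \<in> sets borel" by measurable
  have bad: "?bad k \<in> events" if "k \<in> {1..K}" for k
    using measurable_sets[OF U[OF that] H] by (simp add: vimage_def Int_def conj_commute)
  have "prob {\<xi> \<in> space M. \<delta> < \<bar>?R \<xi> - (1 - \<beta>)\<bar>} \<le> prob (\<Union>k\<in>{1..K}. ?bad k)"
  proof (rule finite_measure_mono_AE)
    show "AE \<xi> in M. \<xi> \<in> {\<xi> \<in> space M. \<delta> < \<bar>?R \<xi> - (1 - \<beta>)\<bar>} \<longrightarrow> \<xi> \<in> (\<Union>k\<in>{1..K}. ?bad k)"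
      using AE_D_weights
    proof eventually_elim
      case (elim \<xi>)
      have "\<bar>?R \<xi> - (1 - \<beta>)\<bar> \<le> \<delta>" if "\<And>k. k \<in> {1..K} \<Longrightarrow> U k \<xi> \<notin> ?H"
      proof -
        have "Quantile (1 - \<tau>) (dirac_mixture {1..K} (w n (D \<xi>)) (\<lambda>k. ereal (U k \<xi>)))
            \<in> {ereal (1 - \<beta> - \<delta>)..ereal (1 - \<beta> + \<delta>)}"
        proof (rule Quantile_dirac_mixture_between)
          show "ereal (U k \<xi>) \<in> {ereal (1 - \<beta> - \<delta>)..ereal (1 - \<beta> + \<delta>)}" if "k \<in> {1..K}" for k
            using \<open>\<And>k. k \<in> {1..K} \<Longrightarrow> U k \<xi> \<notin> ?H\<close>[OF that] by (auto simp: not_less abs_le_iff)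
        qed (use \<tau> elim aggregation_weights_convex[OF w n, of "D \<xi>"] in auto)
        then show ?thesis
          \<comment> \<open>Lying between two real numbers, the quantile is finite, so
            \<open>real_of_ereal\<close> preserves it.\<close>
          by (cases "Quantile (1 - \<tau>) (dirac_mixture {1..K} (w n (D \<xi>)) (\<lambda>k. ereal (U k \<xi>)))") auto
      qed
      then show ?case by force
    qed
    show "(\<Union>k\<in>{1..K}. ?bad k) \<in> events" using bad by (intro sets.finite_UN) auto
  qed
  also have "\<dots> \<le> (\<Sum>k=1..K. prob (?bad k))"
    using bad by (intro finite_measure_subadditive_finite) auto
  also have "\<dots> \<le> (\<Sum>k=1..K. 1 / (4 * (n k * (A / B)\<^sup>2) * \<delta>\<^sup>2))"
  proof (rule sum_mono)
    fix k assume k: "k \<in> {1..K}"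
    \<comment> \<open>Taking \<open>UNIV\<close> in the other coordinates turns their factors into 1
      and extracts the conditional law of \<open>U k\<close> from the product.\<close>
    let ?C = "\<lambda>j. if j = k then ?H else UNIV"
    have eq: "{\<xi> \<in> space M. \<forall>j\<in>{1..K}. U j \<xi> \<in> ?C j} = ?bad k" using k by auto
    have "AE \<xi> in M. prob_given M S D (?bad k) \<xi> =
        (\<Prod>j=1..K. measure (beta_law ((1 - \<beta>) * (n_eff \<omega> n (D \<xi>) j + 1))
                                     (\<beta> * (n_eff \<omega> n (D \<xi>) j + 1))) (?C j))"
      using H by (intro U_law[of ?C, unfolded eq]) simp
    then have "AE \<xi> in M. prob_given M S D (?bad k) \<xi> \<le> 1 / (4 * (n k * (A / B)\<^sup>2) * \<delta>\<^sup>2)"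
      using AE_D_weights
    proof eventually_elim
      case (elim \<xi>)
      let ?\<mu> = "\<lambda>j. beta_law ((1 - \<beta>) * (n_eff \<omega> n (D \<xi>) j + 1)) (\<beta> * (n_eff \<omega> n (D \<xi>) j + 1))"
      have ge: "n j * (A / B)\<^sup>2 \<le> n_eff \<omega> n (D \<xi>) j" "0 < n j * (A / B)\<^sup>2" if "j \<in> {1..K}" for j
        using that n elim AB by (auto intro!: n_eff_ge)
      have "prob_space (?\<mu> j)" if "j \<in> {1..K}" for j
        using ge[OF that] \<beta> by (intro prob_space_beta_law mult_pos_pos) auto
      then have one: "measure (?\<mu> j) UNIV = 1" if "j \<in> {1..K}" for j
        using prob_space.prob_space[of "?\<mu> j"] that by (simp add: beta_law_def)
      have "(\<Prod>j=1..K. measure (?\<mu> j) (?C j)) = (\<Prod>j=1..K. if j = k then measure (?\<mu> k) ?H else 1)"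
        using one by (intro prod.cong) auto
      also have "\<dots> = measure (?\<mu> k) ?H" using k by simp
      also have "\<dots> \<le> 1 / (4 * (n_eff \<omega> n (D \<xi>) k + 1) * \<delta>\<^sup>2)"
      proof -
        \<comment> \<open>With \<open>N = n_eff + 1\<close> the Beta parameters add up to
          \<open>N\<close> and their mean is \<open>1 - \<beta>\<close>.\<close>
        have "(1 - \<beta>) * N + \<beta> * N = N" "(1 - \<beta>) * N / N = 1 - \<beta>" if "0 < N" for N
          using that by (simp_all add: field_simps)
        then show ?thesis
          using beta_law_concentration[of "(1 - \<beta>) * (n_eff \<omega> n (D \<xi>) k + 1)" "\<beta> * (n_eff \<omega> n (D \<xi>) k + 1)" \<delta>]
            ge[OF k] \<beta> \<delta> by simp
      qed
      also have "\<dots> \<le> 1 / (4 * (n k * (A / B)\<^sup>2) * \<delta>\<^sup>2)"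
        using ge[OF k] n[OF k] AB \<delta> less_le_trans[OF ge(2)[OF k] ge(1)[OF k]]
        by (intro divide_left_mono mult_right_mono mult_left_mono mult_pos_pos) auto
      finally show ?case using elim(1) by (simp only:)
    qed
    then show "prob (?bad k) \<le> 1 / (4 * (n k * (A / B)\<^sup>2) * \<delta>\<^sup>2)"
      by (rule prob_le_of_prob_given_le[OF measurable_D bad[OF k]])
  qed
  finally show ?thesis .
qed

end

section \<open>Passage to the limit\<close>

text \<open>There are finitely many agents, so conditions that hold for each large
  \<open>n k\<close> separately hold together along the joint filter, whatever the relative
  rates.\<close>

lemma eventually_sizes_at_top:
  assumes "eventually Q at_top"
  shows "eventually (\<lambda>n. \<forall>k\<in>{1..K}. Q (n k)) (sizes_at_top K)"
proof (rule eventually_ball_finite)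
  show "\<forall>k\<in>{1..K}. eventually (\<lambda>n. Q (n k)) (sizes_at_top K)"
  proof
    fix k assume "k \<in> {1..K}"
    then have "sizes_at_top K \<le> filtercomap (\<lambda>n. n k) at_top"
      unfolding sizes_at_top_def by (rule INF_lower)
    moreover have "eventually (\<lambda>n. Q (n k)) (filtercomap (\<lambda>n. n k) at_top)"
      using assms by (rule eventually_filtercomapI)
    ultimately show "eventually (\<lambda>n. Q (n k)) (sizes_at_top K)"
      by (rule filter_leD)
  qed
qed simp

theorem proposition1:
  fixes K :: nat and \<beta> \<tau> A B :: real
    and MX :: "'x measure" and MY :: "'y measure"
    and PX :: "nat \<Rightarrow> 'x measure" and \<kappa> :: "'x \<Rightarrow> 'y measure"
    and P :: "nat \<Rightarrow> ('x \<times> 'y) measure"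
    and s :: "'x \<times> 'y \<Rightarrow> real" and \<omega> \<omega>_hat :: "nat \<Rightarrow> 'x \<Rightarrow> real"
    and w :: "(nat \<Rightarrow> nat) \<Rightarrow> (nat \<times> nat \<Rightarrow> 'x \<times> 'y) \<Rightarrow> nat \<Rightarrow> real"
    and M :: "(nat \<Rightarrow> nat) \<Rightarrow> 'w measure"
    and Z :: "(nat \<Rightarrow> nat) \<Rightarrow> nat \<times> nat \<Rightarrow> 'w \<Rightarrow> 'x \<times> 'y"
    and D :: "(nat \<Rightarrow> nat) \<Rightarrow> 'w \<Rightarrow> (nat \<times> nat \<Rightarrow> 'x \<times> 'y)"
    and XY :: "(nat \<Rightarrow> nat) \<Rightarrow> 'w \<Rightarrow> 'x \<times> 'y"
    and U :: "(nat \<Rightarrow> nat) \<Rightarrow> nat \<Rightarrow> 'w \<Rightarrow> real"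
    and S :: "(nat \<Rightarrow> nat) \<Rightarrow> (nat \<times> nat \<Rightarrow> 'x \<times> 'y) measure"
  assumes K: "1 \<le> K" and \<beta>: "0 < \<beta>" "\<beta> < 1" and \<tau>: "0 \<le> \<tau>" "\<tau> < 1"
    and PX: "\<And>k. k \<in> {1..K} \<Longrightarrow> PX k \<in> space (prob_algebra MX)"
    and \<kappa>: "\<kappa> \<in> MX \<rightarrow>\<^sub>M prob_algebra MY"
    and P: "\<And>k. P k = joint_law MX MY (PX k) \<kappa>"
    and s: "s \<in> borel_measurable (MX \<Otimes>\<^sub>M MY)"
    and s_cont: "continuous_on UNIV (cdf (distr (P 1) borel s))"
    and ac: "\<And>k. k \<in> {1..K} \<Longrightarrow> absolutely_continuous (P k) (P 1)"
    and \<omega>_meas: "\<And>k. k \<in> {1..K} \<Longrightarrow> \<omega> k \<in> borel_measurable MX"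
    and \<omega>: "\<And>k. k \<in> {1..K} \<Longrightarrow> AE x in PX k. \<omega> k x = enn2real (RN_deriv (PX k) (PX 1) x)"
    and \<omega>_hat: "\<And>k x. k \<in> {1..K} \<Longrightarrow> x \<in> space MX \<Longrightarrow> \<omega>_hat k x = \<omega> k x"
    and AB: "0 < A" "A \<le> 1" "1 \<le> B"
    and \<omega>_bounds: "\<And>k. k \<in> {1..K} \<Longrightarrow> measure (PX k) {x \<in> space MX. \<omega> k x \<in> {A..B}} = 1"
    and w: "aggregation_weights K \<omega> w"
    and M: "\<And>n. prob_space (M n)"
    and Z_indep: "\<And>n. prob_space.indep_vars (M n) (\<lambda>_. MX \<Otimes>\<^sub>M MY) (Z n) (data_index K n)"
    and Z_law: "\<And>n k i. (k, i) \<in> data_index K n \<Longrightarrow> distr (M n) (MX \<Otimes>\<^sub>M MY) (Z n (k, i)) = P k"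
    and S: "\<And>n. S n = PiM (data_index K n) (\<lambda>_. MX \<Otimes>\<^sub>M MY)"
    and D: "\<And>n. D n = (\<lambda>\<xi>. \<lambda>j\<in>data_index K n. Z n j \<xi>)"
    and XY_indep: "\<And>n. independent_rvs (M n) (S n) (D n) (MX \<Otimes>\<^sub>M MY) (XY n)"
    and XY_law: "\<And>n. distr (M n) (MX \<Otimes>\<^sub>M MY) (XY n) = P 1"
    and U_meas: "\<And>n k. k \<in> {1..K} \<Longrightarrow> U n k \<in> borel_measurable (M n)"
    and U_law: "\<And>n C. (\<And>k. k \<in> {1..K} \<Longrightarrow> C k \<in> sets borel) \<Longrightarrow>
      AE \<xi> in M n. prob_given (M n) (S n) (D n) {\<xi> \<in> space (M n). \<forall>k\<in>{1..K}. U n k \<xi> \<in> C k} \<xi> =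
        (\<Prod>k=1..K. measure (beta_law ((1 - \<beta>) * (n_eff \<omega> n (D n \<xi>) k + 1))
                                     (\<beta> * (n_eff \<omega> n (D n \<xi>) k + 1))) (C k))"
  shows "((\<lambda>n. levy_dist
      (distr (M n) borel
        (prob_given (M n) (S n) (D n)
          {\<xi> \<in> space (M n). snd (XY n \<xi>) \<in>
             wqq_prediction_set MY s \<omega>_hat K n (w n (D n \<xi>)) (D n \<xi>) \<beta> \<tau> (fst (XY n \<xi>))}))
      (distr (M n) borel
        (\<lambda>\<xi>. real_of_ereal
          (Quantile (1 - \<tau>) (dirac_mixture {1..K} (w n (D n \<xi>)) (\<lambda>k. ereal (U n k \<xi>)))))))
    \<longlongrightarrow> 0) (sizes_at_top K)"
proof (rule tendstoI)
  fix e :: real assume e: "0 < e"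
  \<comment> \<open>The first term gives \<open>2 * \<delta> < e\<close> for the Levy bound; the
    others keep \<open>\<delta>\<close> below \<open>\<beta>\<close> and \<open>1 - \<beta>\<close>,
    as the choice of score thresholds requires.\<close>
  define \<delta> where "\<delta> = min (e / 3) (min (\<beta> / 2) ((1 - \<beta>) / 2))"
  have \<delta>: "0 < \<delta>" "2 * \<delta> < e" "\<delta> < \<beta>" "\<delta> < 1 - \<beta>"
    using e \<beta> by (auto simp: \<delta>_def min_def)
  \<comment> \<open>Three conditions on a single sample size \<open>m\<close> follow: it absorbs the
    test weight, and each agent's failure probability, on the coverage side and on the Beta side, is
    below \<open>\<delta> / K\<close>, so that each sum over agents is at most
    \<open>\<delta>\<close>.\<close>
  have "eventually (\<lambda>m. B / (\<delta> / 2) \<le> real m) at_top"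
    by (rule filterlim_at_top[THEN iffD1, OF filterlim_real_sequentially, rule_format])
  moreover have "(\<lambda>m. 6 * exp (- 2 * real m * (\<delta> / 4)\<^sup>2 / B\<^sup>2)) \<longlonglongrightarrow> 0"
  proof -
    have "6 * exp (- 2 * real m * (\<delta> / 4)\<^sup>2 / B\<^sup>2) = 6 * exp (- (2 * (\<delta> / 4)\<^sup>2 / B\<^sup>2)) ^ m" for m
      by (simp add: exp_of_nat_mult[symmetric] mult_ac)
    moreover have "(\<lambda>m. exp (- (2 * (\<delta> / 4)\<^sup>2 / B\<^sup>2)) ^ m) \<longlonglongrightarrow> 0"
      using \<delta> AB by (intro LIMSEQ_power_zero) simp
    ultimately show ?thesis by (simp only: tendsto_mult_right_zero)
  qed
  then have "eventually (\<lambda>m. 6 * exp (- 2 * real m * (\<delta> / 4)\<^sup>2 / B\<^sup>2) < \<delta> / K) at_top"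
    by (rule order_tendstoD) (use \<delta> K in auto)
  moreover have "(\<lambda>m. 1 / (4 * (real m * (A / B)\<^sup>2) * \<delta>\<^sup>2)) \<longlonglongrightarrow> 0"
    using tendsto_mult_right_zero[OF lim_1_over_n, of "1 / (4 * (A / B)\<^sup>2 * \<delta>\<^sup>2)"]
    by (simp add: mult_ac)
  then have "eventually (\<lambda>m. 1 / (4 * (real m * (A / B)\<^sup>2) * \<delta>\<^sup>2) < \<delta> / K) at_top"
    by (rule order_tendstoD) (use \<delta> K in auto)
  ultimately have "eventually (\<lambda>m. B / (\<delta> / 2) \<le> real m \<and>
      6 * exp (- 2 * real m * (\<delta> / 4)\<^sup>2 / B\<^sup>2) < \<delta> / K \<and>
      1 / (4 * (real m * (A / B)\<^sup>2) * \<delta>\<^sup>2) < \<delta> / K) at_top"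
    by eventually_elim auto
  from eventually_sizes_at_top[OF this, of K] show "eventually (\<lambda>n. dist (levy_dist
      (distr (M n) borel
        (prob_given (M n) (S n) (D n)
          {\<xi> \<in> space (M n). snd (XY n \<xi>) \<in>
             wqq_prediction_set MY s \<omega>_hat K n (w n (D n \<xi>)) (D n \<xi>) \<beta> \<tau> (fst (XY n \<xi>))}))
      (distr (M n) borel
        (\<lambda>\<xi>. real_of_ereal
          (Quantile (1 - \<tau>) (dirac_mixture {1..K} (w n (D n \<xi>)) (\<lambda>k. ereal (U n k \<xi>))))))) 0 < e) (sizes_at_top K)"
  proof eventually_elim
    case (elim n)
    interpret prob_space "M n" by (rule M)
    interpret covariate_shift_model "M n" K \<beta> \<tau> A B MX MY PX \<kappa> P s \<omega> n "Z n" "D n" "S n"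
      by unfold_locales (fact K \<beta> \<tau> PX \<kappa> P s ac \<omega>_meas \<omega> AB \<omega>_bounds Z_indep Z_law S D)+
    have n: "B \<le> \<delta> / 2 * n k" if "k \<in> {1..K}" for k
      using elim that \<delta> by (simp add: field_simps)
    have n_pos: "0 < n k" if "k \<in> {1..K}" for k
      using n[OF that] AB by (intro gr0I) auto
    let ?L = "prob_given (M n) (S n) (D n)
          {\<xi> \<in> space (M n). snd (XY n \<xi>) \<in>
             wqq_prediction_set MY s \<omega>_hat K n (w n (D n \<xi>)) (D n \<xi>) \<beta> \<tau> (fst (XY n \<xi>))}"
    let ?R = "\<lambda>\<xi>. real_of_ereal
          (Quantile (1 - \<tau>) (dirac_mixture {1..K} (w n (D n \<xi>)) (\<lambda>k. ereal (U n k \<xi>))))"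
    have L [measurable]: "?L \<in> borel_measurable (M n)"
      unfolding prob_given_def by (rule borel_measurable_cond_exp2)
    have R [measurable]: "?R \<in> borel_measurable (M n)"
      using w U_meas by (rule borel_measurable_Quantile_U)
    have sum_le: "(\<Sum>k=1..K. f k) \<le> \<delta>" if "\<And>k. k \<in> {1..K} \<Longrightarrow> f k < \<delta> / K" for f
    proof -
      have "(\<Sum>k=1..K. f k) \<le> (\<Sum>k=1..K. \<delta> / K)" using that by (intro sum_mono) (simp add: less_imp_le)
      then show ?thesis using K by simp
    qed
    have distr: "real_distribution (distr (M n) borel f)" "measure (distr (M n) borel f) {x. \<delta> < \<bar>x - (1 - \<beta>)\<bar>} \<le> \<delta>"
      if [measurable]: "f \<in> borel_measurable (M n)" and "prob {\<xi> \<in> space (M n). \<delta> < \<bar>f \<xi> - (1 - \<beta>)\<bar>} \<le> \<delta>" for f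
    proof -
      show "real_distribution (distr (M n) borel f)" by (rule real_distribution_distr) measurable
      have "measure (distr (M n) borel f) {x. \<delta> < \<bar>x - (1 - \<beta>)\<bar>} = prob {\<xi> \<in> space (M n). \<delta> < \<bar>f \<xi> - (1 - \<beta>)\<bar>}"
        by (subst measure_distr) (auto intro!: arg_cong[of _ _ prob])
      then show "measure (distr (M n) borel f) {x. \<delta> < \<bar>x - (1 - \<beta>)\<bar>} \<le> \<delta>" using that by simp
    qed
    have "prob {\<xi> \<in> space (M n). \<delta> < \<bar>?L \<xi> - (1 - \<beta>)\<bar>} \<le> (\<Sum>k=1..K. 6 * exp (- 2 * n k * (\<delta> / 4)\<^sup>2 / B\<^sup>2))"
      by (rule coverage_concentration[OF \<omega>_hat w s_cont XY_indep XY_law \<delta>(1,3,4) n])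
    also have "\<dots> \<le> \<delta>" using elim by (intro sum_le) auto
    finally have conc_L: "prob {\<xi> \<in> space (M n). \<delta> < \<bar>?L \<xi> - (1 - \<beta>)\<bar>} \<le> \<delta>" .
    have "prob {\<xi> \<in> space (M n). \<delta> < \<bar>?R \<xi> - (1 - \<beta>)\<bar>} \<le> (\<Sum>k=1..K. 1 / (4 * (n k * (A / B)\<^sup>2) * \<delta>\<^sup>2))"
      by (rule quantile_concentration[OF w U_meas U_law n_pos \<delta>(1)])
    also have "\<dots> \<le> \<delta>" using elim by (intro sum_le) auto
    finally have conc_R: "prob {\<xi> \<in> space (M n). \<delta> < \<bar>?R \<xi> - (1 - \<beta>)\<bar>} \<le> \<delta>" .
    show ?case
      using levy_dist_le_concentration[OF distr(1)[OF L conc_L] distr(1)[OF R conc_R] \<delta>(1)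
          distr(2)[OF L conc_L] distr(2)[OF R conc_R]] \<delta>(2)
      by (simp add: dist_real_def)
  qed
qed

end
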